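(* Let $P_1,\ldots,P_N, A \subseteq \mathbb{N}^n$ be finite sets of exponent vectors satisfying $\{0\} \cup A \subseteq B := P_1 \cup \cdots \cup P_N$. Let $f \in \mathbb{R}[x]_A$ and let $X \subseteq \mathbb{R}^n$ have non-empty interior. Then $$\sup\{ \lambda \in \mathbb{R} : f - \lambda \in \mathcal{P}_{P_1}(X) + \cdots + \mathcal{P}_{P_N}(X)\} = \inf\{ L_v(f) : v \in \mathbb{R}^B,\ v_0 = 1,\ v_{P_i} \in \mathcal{C}_{P_i}(X) \ \text{for every} \ i \in [N]\}.$$ Furthermore, if $0 \in P_i$ for every $i \in [N]$, then the infimum is equal to $$\inf\{ L_v(f) : v \in \mathbb{R}^B,\ v_{P_i} \in \mathcal{M}_{P_i}(X) \ \text{for every} \ i \in [N]\}.$$ If, additionally, the set $X$ is compact, then the supremum and the infimum are attained and can be replaced by a maximum and a minimum, respectively.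
   Context: $\mathbb{N}$ contains $0$; $[N]=\{1,\ldots,N\}$; $x^\alpha = x_1^{\alpha_1}\cdots x_n^{\alpha_n}$. For a finite $P \subseteq \mathbb{N}^n$: $\mathbb{R}[x]_P$ is the space of polynomials in $\mathbb{R}[x_1,\ldots,x_n]$ that are linear combinations of the monomials $x^\alpha$, $\alpha\in P$; $\mathcal{P}_P(X)$ is the set of polynomials in $\mathbb{R}[x]_P$ that are non-negative on $X$; $\mathcal{M}_P(X) := \operatorname{conv}\{(x^\alpha)_{\alpha \in P} : x \in X\} \subseteq \mathbb{R}^P$; $\mathcal{C}_P(X) := \overline{\operatorname{cone}\{(x^\alpha)_{\alpha\in P} : x \in X\}} \subseteq \mathbb{R}^P$ (topological closure of the convex conic hull). For $v \in \mathbb{R}^B$ and $P \subseteq B$, $v_P = (v_\alpha)_{\alpha\in P}$, and $L_v(\sum_\alpha f_\alpha x^\alpha) = \sum_\alpha f_\alpha v_\alpha$. Here $v_0$ is the coordinate indexed by the zero exponent vector. *)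

theory Defs
  imports "HOL-Analysis.Analysis" "HOL-Analysis.Finite_Function_Topology"
begin

text \<open>
  Exponent vectors are elements of \<open>nat ^ 'n\<close>, where \<open>'n\<close> is the finite index set of the variables.
  Polynomials in \<open>\<real>[x]\<close> are the elements of the monoid algebra \<open>(nat ^ 'n, real) poly_mapping\<close>.
  For a finite set \<open>P\<close> of exponents, the space \<open>\<real>\<^sup>P\<close> is represented by the finitely supported
  families vanishing outside \<open>P\<close>. The norm that the library puts on \<open>poly_mapping\<close> is the 1-norm, so
  \<open>\<real>\<^sup>P\<close> carries its usual topology and is a closed subspace; hulls and closures of subsets of
  \<open>\<real>\<^sup>P\<close> are therefore the same in that type as in \<open>\<real>\<^sup>P\<close>.
\<close>

type_synonym 'n mpoly = "(nat ^ 'n, real) poly_mapping"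
type_synonym 'n coords = "(nat ^ 'n, real) poly_mapping"

definition monomial :: "real ^ 'n \<Rightarrow> nat ^ 'n \<Rightarrow> real" where
  "monomial x \<alpha> = (\<Prod>j\<in>UNIV. (x $ j) ^ (\<alpha> $ j))"

definition peval :: "('n::finite) mpoly \<Rightarrow> real ^ 'n \<Rightarrow> real" where
  "peval f x = (\<Sum>\<alpha>\<in>Poly_Mapping.keys f. Poly_Mapping.lookup f \<alpha> * monomial x \<alpha>)"

definition const_poly :: "real \<Rightarrow> ('n::finite) mpoly" where
  "const_poly c = Poly_Mapping.single 0 c"

definition poly_space :: "(nat ^ 'n) set \<Rightarrow> ('n::finite) mpoly set" where
  "poly_space P = {f. Poly_Mapping.keys f \<subseteq> P}"

definition nonneg_polys :: "(nat ^ 'n) set \<Rightarrow> (real ^ 'n) set \<Rightarrow> ('n::finite) mpoly set" where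
  "nonneg_polys P X = {f \<in> poly_space P. \<forall>x\<in>X. 0 \<le> peval f x}"

definition coord_space :: "(nat ^ 'n) set \<Rightarrow> ('n::finite) coords set" where
  "coord_space P = {v. Poly_Mapping.keys v \<subseteq> P}"

text \<open>The vector \<open>(g \<alpha>)\<^bsub>\<alpha> \<in> P\<^esub>\<close> of \<open>\<real>\<^sup>P\<close>; meaningful for finite \<open>P\<close> only.\<close>

definition coord_vec :: "(nat ^ 'n) set \<Rightarrow> (nat ^ 'n \<Rightarrow> real) \<Rightarrow> ('n::finite) coords" where
  "coord_vec P g = (\<Sum>\<alpha>\<in>P. Poly_Mapping.single \<alpha> (g \<alpha>))"

definition moment_vec :: "(nat ^ 'n) set \<Rightarrow> real ^ 'n \<Rightarrow> ('n::finite) coords" where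
  "moment_vec P x = coord_vec P (monomial x)"

definition restrict_coords :: "(nat ^ 'n) set \<Rightarrow> ('n::finite) coords \<Rightarrow> 'n coords" where
  "restrict_coords P v = coord_vec P (Poly_Mapping.lookup v)"

definition moment_body :: "(nat ^ 'n) set \<Rightarrow> (real ^ 'n) set \<Rightarrow> ('n::finite) coords set" where
  "moment_body P X = convex hull (moment_vec P ` X)"

definition moment_cone :: "(nat ^ 'n) set \<Rightarrow> (real ^ 'n) set \<Rightarrow> ('n::finite) coords set" where
  "moment_cone P X = closure (convex_cone hull (moment_vec P ` X))"

definition Lfun :: "('n::finite) coords \<Rightarrow> 'n mpoly \<Rightarrow> real" where
  "Lfun v f = (\<Sum>\<alpha>\<in>Poly_Mapping.keys f. Poly_Mapping.lookup f \<alpha> * Poly_Mapping.lookup v \<alpha>)"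

text \<open>The feasible sets of the three optimization problems. The sum of sets of polynomials is the
  Minkowski sum.\<close>

definition primal_feasible ::
    "nat \<Rightarrow> (nat \<Rightarrow> (nat ^ 'n) set) \<Rightarrow> (real ^ 'n) set \<Rightarrow> ('n::finite) mpoly \<Rightarrow> real set" where
  "primal_feasible N P X f = {c. f - const_poly c \<in> (\<Sum>i\<in>{1..N}. nonneg_polys (P i) X)}"

definition cone_feasible ::
    "nat \<Rightarrow> (nat \<Rightarrow> (nat ^ 'n) set) \<Rightarrow> (real ^ 'n) set \<Rightarrow> ('n::finite) coords set" where
  "cone_feasible N P X =
     {v \<in> coord_space (\<Union>i\<in>{1..N}. P i).
        Poly_Mapping.lookup v 0 = 1 \<and>
        (\<forall>i\<in>{1..N}. restrict_coords (P i) v \<in> moment_cone (P i) X)}"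

definition body_feasible ::
    "nat \<Rightarrow> (nat \<Rightarrow> (nat ^ 'n) set) \<Rightarrow> (real ^ 'n) set \<Rightarrow> ('n::finite) coords set" where
  "body_feasible N P X =
     {v \<in> coord_space (\<Union>i\<in>{1..N}. P i).
        \<forall>i\<in>{1..N}. restrict_coords (P i) v \<in> moment_body (P i) X}"

end

theory Submission
  imports Defs
begin

text \<open>
  The supremum and the infimum are a dual pair of conic programs: the dual of \<open>\<P>\<^sub>P(X)\<close> is \<open>\<C>\<^sub>P(X)\<close>, so
  a \<open>c\<close> that is not primal feasible is excluded by a dual feasible \<open>v\<close> with \<open>L\<^sub>v(f) < c\<close>, provided that
  the sum \<open>K\<close> of the cones \<open>\<P>\<^bsub>P\<^sub>i\<^esub>(X)\<close> is closed. A polynomial that vanishes on a set with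
  interior is zero, so the moment vectors span; hence some functional \<open>w\<close> lies in the interior of all
  the moment cones at once. It bounds the coefficients of every summand of an element \<open>g\<close> of \<open>K\<close> in
  terms of \<open>L\<^sub>w(g)\<close>, and this makes \<open>K\<close> closed. When \<open>0 \<in> P\<^sub>i\<close> for all \<open>i\<close>, moving a feasible \<open>v\<close>
  slightly towards \<open>w\<close> puts its restrictions into the convex hulls \<open>\<M>\<^bsub>P\<^sub>i\<^esub>(X)\<close>, so the two infima agree.
  For compact \<open>X\<close> these hulls are compact by Caratheodory's theorem, the minimum is attained, and its
  value is primal feasible, as no dual feasible \<open>v\<close> excludes it.
\<close>

subsection \<open>Finitely supported families as a finite-dimensional space\<close>

lemma lookup_scaleR [simp]:
  "Poly_Mapping.lookup (c *\<^sub>R v) a = c *\<^sub>R Poly_Mapping.lookup v a"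
  by (simp add: scaleR_poly_mapping_def)

lemma norm_eq_sum_keys: "norm v = (\<Sum>a\<in>Poly_Mapping.keys v. norm (Poly_Mapping.lookup v a))"
  by (simp add: norm_poly_mapping_def dist_poly_mapping_def)

lemma norm_lookup_le: "norm (Poly_Mapping.lookup v a) \<le> norm v"
proof (cases "a \<in> Poly_Mapping.keys v")
  case True
  then show ?thesis
    unfolding norm_eq_sum_keys by (intro member_le_sum) auto
qed (simp add: in_keys_iff)

lemma bounded_linear_lookup: "bounded_linear (\<lambda>v. Poly_Mapping.lookup v a)"
  by (rule bounded_linear_intro[where K=1]) (simp_all add: lookup_add norm_lookup_le)

lemmas continuous_on_lookup [continuous_intros] =
  bounded_linear.continuous_on[OF bounded_linear_lookup]

lemma bounded_linear_single:
  "bounded_linear (\<lambda>t. Poly_Mapping.single a t :: ('a, 'b::real_normed_vector) poly_mapping)"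
  by (rule bounded_linear_intro[where K=1])
    (auto intro!: poly_mapping_eqI simp: lookup_add lookup_single when_def norm_eq_sum_keys)

lemma lookup_coord_vec:
  "finite P \<Longrightarrow> Poly_Mapping.lookup (coord_vec P g) a = (if a \<in> P then g a else 0)"
  by (simp add: coord_vec_def lookup_sum lookup_single when_def)

lemma lookup_restrict_coords:
  "finite P \<Longrightarrow> Poly_Mapping.lookup (restrict_coords P v) a =
     (if a \<in> P then Poly_Mapping.lookup v a else 0)"
  by (simp add: restrict_coords_def lookup_coord_vec)

lemma lookup_moment_vec:
  "finite P \<Longrightarrow> Poly_Mapping.lookup (moment_vec P x) a = (if a \<in> P then monomial x a else 0)"
  by (simp add: moment_vec_def lookup_coord_vec)

lemma coord_space_iff: "v \<in> coord_space P \<longleftrightarrow> (\<forall>a. a \<notin> P \<longrightarrow> Poly_Mapping.lookup v a = 0)"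
  by (auto simp: coord_space_def in_keys_iff)

lemma poly_space_eq_coord_space: "poly_space P = coord_space P"
  by (simp add: poly_space_def coord_space_def)

lemma moment_vec_in_coord_space: "finite P \<Longrightarrow> moment_vec P x \<in> coord_space P"
  by (simp add: coord_space_iff lookup_moment_vec)

lemma restrict_coords_in_coord_space: "finite P \<Longrightarrow> restrict_coords P v \<in> coord_space P"
  by (simp add: coord_space_iff lookup_restrict_coords)

lemma restrict_moment_vec:
  "finite B \<Longrightarrow> P \<subseteq> B \<Longrightarrow> restrict_coords P (moment_vec B x) = moment_vec P x"
  by (rule poly_mapping_eqI)
    (auto simp: lookup_restrict_coords lookup_moment_vec finite_subset)

lemma bounded_linear_restrict_coords:
  fixes P :: "(nat ^ 'n::finite) set"
  assumes "finite P"
  shows "bounded_linear (restrict_coords P)"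
proof -
  have "bounded_linear (\<lambda>v::'n coords. \<Sum>a\<in>P. Poly_Mapping.single a (Poly_Mapping.lookup v a))"
    by (intro bounded_linear_sum
        bounded_linear_compose[OF bounded_linear_single bounded_linear_lookup])
  moreover have "restrict_coords P = (\<lambda>v. \<Sum>a\<in>P. Poly_Mapping.single a (Poly_Mapping.lookup v a))"
    by (simp add: fun_eq_iff restrict_coords_def coord_vec_def)
  ultimately show ?thesis
    by simp
qed

lemma subspace_coord_space: "subspace (coord_space P)"
  by (auto simp: subspace_def coord_space_iff lookup_add)

lemma closed_coord_space: "closed (coord_space P)"
proof -
  have "coord_space P = (\<Inter>a\<in>-P. {v. Poly_Mapping.lookup v a = 0})"
    by (auto simp: coord_space_iff)
  then show ?thesis
    by (auto intro!: closed_INT closed_Collect_eq continuous_intros)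
qed

section \<open>The pairing of polynomials with coordinate vectors\<close>

lemma Lfun_eq_sum:
  assumes "finite B" "f \<in> coord_space B"
  shows "Lfun v f = (\<Sum>a\<in>B. Poly_Mapping.lookup f a * Poly_Mapping.lookup v a)"
  using assms unfolding Lfun_def
  by (intro sum.mono_neutral_left) (auto simp: coord_space_def in_keys_iff)

text \<open>Polynomials and coordinate vectors share one type, so the pairing is the standard
  symmetric bilinear form. This transfers linearity between the arguments and later allows a
  separating vector to be read as a polynomial.\<close>

lemma Lfun_commute: "Lfun v f = Lfun f v"
proof -
  let ?B = "Poly_Mapping.keys v \<union> Poly_Mapping.keys f"
  have "v \<in> coord_space ?B" "f \<in> coord_space ?B"
    by (auto simp: coord_space_def)
  then show ?thesis
    by (simp add: Lfun_eq_sum[where B="?B"] mult.commute)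
qed

lemma bounded_linear_Lfun_left: "bounded_linear (\<lambda>v. Lfun v f)"
  unfolding Lfun_def
  by (intro bounded_linear_sum bounded_linear_const_mult bounded_linear_lookup)

lemma bounded_linear_Lfun_right: "bounded_linear (Lfun v)"
proof -
  have "Lfun v = (\<lambda>f. Lfun f v)"
    by (rule ext) (rule Lfun_commute)
  then show ?thesis
    by (simp only: bounded_linear_Lfun_left)
qed

lemmas Lfun_simps =
  linear_add[OF bounded_linear.linear[OF bounded_linear_Lfun_left]]
  linear_add[OF bounded_linear.linear[OF bounded_linear_Lfun_right]]
  linear_diff[OF bounded_linear.linear[OF bounded_linear_Lfun_left]]
  linear_diff[OF bounded_linear.linear[OF bounded_linear_Lfun_right]]
  linear_cmul[OF bounded_linear.linear[OF bounded_linear_Lfun_left]]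
  linear_cmul[OF bounded_linear.linear[OF bounded_linear_Lfun_right]]
  linear_0[OF bounded_linear.linear[OF bounded_linear_Lfun_left]]
  linear_0[OF bounded_linear.linear[OF bounded_linear_Lfun_right]]

lemma Lfun_single [simp]: "Lfun v (Poly_Mapping.single a c) = c * Poly_Mapping.lookup v a"
  by (simp add: Lfun_def)

lemma Lfun_const_poly [simp]: "Lfun v (const_poly c) = c * Poly_Mapping.lookup v 0"
  by (simp add: const_poly_def)

lemma Lfun_self_pos: "v \<noteq> 0 \<Longrightarrow> 0 < Lfun v v"
  unfolding Lfun_def by (intro sum_pos) (auto simp: in_keys_iff zero_less_mult_iff)

lemma Lfun_restrict_coords:
  assumes "finite P" "f \<in> coord_space P"
  shows "Lfun (restrict_coords P v) f = Lfun v f"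
  using assms by (simp add: Lfun_eq_sum[OF assms] lookup_restrict_coords)

lemma Lfun_moment_vec:
  assumes "finite P" "f \<in> coord_space P"
  shows "Lfun (moment_vec P x) f = peval f x"
proof -
  have "peval f x = (\<Sum>a\<in>P. Poly_Mapping.lookup f a * monomial x a)"
    using assms unfolding peval_def
    by (intro sum.mono_neutral_left) (auto simp: coord_space_def in_keys_iff)
  then show ?thesis
    using assms by (simp add: Lfun_eq_sum[OF assms] lookup_moment_vec)
qed

section \<open>Compact boxes and separation from a closed convex cone\<close>

lemma compact_set_sum:
  fixes S :: "'i \<Rightarrow> 'a::real_normed_vector set"
  assumes "finite I" "\<And>i. i \<in> I \<Longrightarrow> compact (S i)"
  shows "compact (\<Sum>i\<in>I. S i)"
  using assms
proof (induction I rule: finite_induct)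
  case (insert i I)
  have "S i + (\<Sum>i\<in>I. S i) = {x + y |x y. x \<in> S i \<and> y \<in> (\<Sum>i\<in>I. S i)}"
    by (auto simp: set_plus_def)
  then show ?case
    using insert by (simp add: compact_sums)
qed simp

text \<open>For \<open>R \<ge> 0\<close> this is the closed ball about 0 in the maximum norm of
  \<open>coord_space B\<close>. Bounds on single coordinates are what the later estimates
  produce.\<close>

definition coord_box :: "(nat ^ 'n) set \<Rightarrow> real \<Rightarrow> ('n::finite) coords set" where
  "coord_box B R = {v \<in> coord_space B. \<forall>a. \<bar>Poly_Mapping.lookup v a\<bar> \<le> R}"

lemma sum_single_lookup:
  assumes "finite B" "v \<in> coord_space B"
  shows "(\<Sum>a\<in>B. Poly_Mapping.single a (Poly_Mapping.lookup v a)) = v"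
  using assms
  by (intro poly_mapping_eqI) (simp add: lookup_sum lookup_single when_def coord_space_iff)

lemma compact_coord_box:
  assumes "finite B" 
  shows "compact (coord_box B R)"
proof -
  let ?S = "\<Sum>a\<in>B. Poly_Mapping.single a ` {-R..R}"
  have "compact ?S"
    by (intro compact_set_sum assms compact_continuous_image compact_Icc
        bounded_linear.continuous_on[OF bounded_linear_single] continuous_on_id)
  moreover have "closed (coord_box B R)"
  proof -
    have "coord_box B R = coord_space B \<inter> (\<Inter>a. {v. \<bar>Poly_Mapping.lookup v a\<bar> \<le> R})"
      by (auto simp: coord_box_def)
    then show ?thesis
      by (auto intro!: closed_Int closed_coord_space closed_INT closed_Collect_le continuous_intros)
  qed
  moreover have "coord_box B R \<subseteq> ?S"
  proof
    fix v assume v: "v \<in> coord_box B R"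
    then have "v = (\<Sum>a\<in>B. Poly_Mapping.single a (Poly_Mapping.lookup v a))"
      using assms by (simp add: coord_box_def sum_single_lookup)
    moreover have "\<forall>a\<in>B. Poly_Mapping.single a (Poly_Mapping.lookup v a) \<in> Poly_Mapping.single a ` {-R..R}"
      using v by (auto simp: coord_box_def abs_le_iff intro!: imageI) (metis minus_le_iff)
    ultimately show "v \<in> ?S"
      unfolding set_sum_alt[OF assms] by blast
  qed
  ultimately show ?thesis
    using closed_Int_compact[of "coord_box B R" ?S] by (simp add: Int_absorb2)
qed

lemma compact_closed_subset_coord_box:
  assumes "finite B" "closed S" "S \<subseteq> coord_box B R"
  shows "compact S"
  using closed_Int_compact[OF assms(2) compact_coord_box[OF assms(1), of R]] assms(3)
  by (simp add: Int_absorb2)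

text \<open>The separating functional is the residual of the projection of \<open>f\<close> onto \<open>K\<close>; the library's
  separation theorems do not apply, as \<open>poly_mapping\<close> is not a Euclidean space.\<close>

lemma separate_closed_convex_cone:
  assumes "finite B" "closed K" "convex_cone K" "K \<subseteq> coord_space B"
    and f: "f \<in> coord_space B" "f \<notin> K"
  obtains v where "v \<in> coord_space B" "\<And>y. y \<in> K \<Longrightarrow> 0 \<le> Lfun v y" "Lfun v f < 0"
proof -
  \<comment> \<open>\<open>D\<close> is the squared Euclidean distance to \<open>f\<close>; its
    minimiser over \<open>K\<close> is the projection of \<open>f\<close>.\<close>
  define D where "D y = Lfun (y - f) (y - f)" for y
  have D: "D y = (\<Sum>a\<in>B. (Poly_Mapping.lookup y a - Poly_Mapping.lookup f a)\<^sup>2)" if "y \<in> K" for y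
  proof -
    have "y - f \<in> coord_space B"
      using that assms by (auto simp: subspace_diff subspace_coord_space)
    then show ?thesis
      by (simp add: D_def Lfun_eq_sum[OF assms(1)] lookup_minus power2_eq_square)
  qed
  have K0: "0 \<in> K"
    using assms(3) by (rule convex_cone_contains_0)
  \<comment> \<open>A point at least as close to \<open>f\<close> as 0 differs from \<open>f\<close>
    by at most \<open>sqrt (D 0)\<close> in each coordinate. The minimisation over \<open>K\<close>
    thus takes place in a compact box.\<close>
  define R where "R = norm f + sqrt (D 0)"
  have D0: "0 \<le> D 0"
    by (simp add: D[OF K0] sum_nonneg)
  have box: "y \<in> coord_box B R" if y: "y \<in> K" "D y \<le> D 0" for y
  proof -
    have "\<bar>Poly_Mapping.lookup y a\<bar> \<le> R" for a
    proof (cases "a \<in> B")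
      case True
      have "(Poly_Mapping.lookup y a - Poly_Mapping.lookup f a)\<^sup>2 \<le> D y"
        unfolding D[OF y(1)] using True assms(1) by (intro member_le_sum) auto
      also have "\<dots> \<le> D 0" by fact
      finally have "\<bar>Poly_Mapping.lookup y a - Poly_Mapping.lookup f a\<bar> \<le> sqrt (D 0)"
        by (simp add: real_le_rsqrt)
      moreover have "\<bar>Poly_Mapping.lookup f a\<bar> \<le> norm f"
        using norm_lookup_le[of f a] by simp
      ultimately show ?thesis
        unfolding R_def by linarith
    next
      case False
      then show ?thesis
        using y assms D0 by (auto simp: coord_space_iff R_def subset_iff)
    qed
    then show ?thesis
      using y assms by (auto simp: coord_box_def)
  qed
  have "compact (K \<inter> coord_box B R)"
    by (intro closed_Int_compact compact_coord_box assms)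
  moreover have "K \<inter> coord_box B R \<noteq> {}"
    using box[OF K0] K0 by auto
  moreover have "continuous_on (K \<inter> coord_box B R) D"
  proof -
    have "continuous_on (K \<inter> coord_box B R)
        (\<lambda>y. \<Sum>a\<in>B. (Poly_Mapping.lookup y a - Poly_Mapping.lookup f a)\<^sup>2)"
      by (intro continuous_intros)
    then show ?thesis
      by (rule continuous_on_eq) (simp add: D)
  qed
  ultimately obtain p where p: "p \<in> K" and "\<And>y. y \<in> K \<inter> coord_box B R \<Longrightarrow> D p \<le> D y"
    by (metis IntE continuous_attains_inf)
  then have min: "D p \<le> D y" if "y \<in> K" for y
    using that box[OF that] box[OF K0] K0 by (metis IntI linear order_trans)
  define v where "v = p - f"
  have v: "v \<in> coord_space B"
    using p assms by (auto simp: v_def subspace_diff subspace_coord_space)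
  have expand: "D (p + t *\<^sub>R y) = D p + t * (2 * Lfun v y + t * Lfun y y)" for t y
  proof -
    have "D (p + t *\<^sub>R y) = Lfun (v + t *\<^sub>R y) (v + t *\<^sub>R y)"
      by (simp add: D_def v_def algebra_simps)
    then show ?thesis
      using Lfun_commute[of y v] by (simp add: Lfun_simps D_def v_def[symmetric] algebra_simps)
  qed
  \<comment> \<open>First-order optimality: along a direction \<open>y\<close> that stays in
    \<open>K\<close> for \<open>t\<close> up to 1, \<open>D\<close> does not fall below
    \<open>D p\<close>. Dividing the increment in \<open>expand\<close> by \<open>t\<close> and
    letting \<open>t\<close> tend to 0 leaves the linear term.\<close>
  have nonneg: "0 \<le> 2 * Lfun v y" if K: "\<And>t. 0 < t \<Longrightarrow> t \<le> 1 \<Longrightarrow> p + t *\<^sub>R y \<in> K" for y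
  proof (rule tendsto_lowerbound)
    have "((\<lambda>t. 2 * Lfun v y + t * Lfun y y) \<longlongrightarrow> 2 * Lfun v y + 0 * Lfun y y) (at_right 0)"
      by (intro tendsto_intros)
    then show "((\<lambda>t. 2 * Lfun v y + t * Lfun y y) \<longlongrightarrow> 2 * Lfun v y) (at_right 0)"
      by simp
    have *: "0 \<le> 2 * Lfun v y + t * Lfun y y" if t: "0 < t" "t < 1" for t :: real
      using min[OF K[of t]] t
      by (simp add: expand zero_le_mult_iff)
    then show "\<forall>\<^sub>F t in at_right 0. 0 \<le> 2 * Lfun v y + t * Lfun y y"
      by (intro eventually_at_rightI[of 0 1] *) auto
  qed simp
  show ?thesis
  proof
    show "v \<in> coord_space B" by fact
    show "0 \<le> Lfun v y" if "y \<in> K" for y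
      using nonneg[of y] p that assms(3) by (simp add: convex_cone_add convex_cone_scaleR)
    \<comment> \<open>Moving from \<open>p\<close> towards the apex stays in the cone, so
      \<open>- p\<close> is an admissible direction too.\<close>
    have "p + t *\<^sub>R (- p) \<in> K" if "t \<le> 1" for t
      using convex_cone_scaleR[OF assms(3), of "1 - t" p] p that
      by (simp add: scaleR_diff_left)
    then have "Lfun v p \<le> 0"
      using nonneg[of "- p"] Lfun_simps(6)[of v "-1" p] by simp
    moreover have "v \<noteq> 0"
      using f p by (auto simp: v_def)
    then have "0 < Lfun v p - Lfun v f"
      using Lfun_self_pos[of v] Lfun_simps(4)[of v p f] by (simp add: v_def)
    ultimately show "Lfun v f < 0"
      by simp
  qed
qed

subsection \<open>Polynomials and moment cones\<close>

text \<open>Induction over the variables: with the coordinates other than \<open>j\<close> fixed,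
  the sum is a univariate polynomial that vanishes on an interval, so each of its coefficients is
  zero. These coefficients involve only the variables in \<open>J\<close>, and distinct exponents in
  \<open>S\<close> may agree there; hence the conclusion concerns sums of \<open>c\<close> over
  classes of exponents.\<close>

lemma coeff_sums_zero_of_zero_on_box:
  fixes a :: "real ^ 'n::finite" and c :: "nat ^ 'n \<Rightarrow> real"
  assumes "finite J" "finite S" "0 < e"
    and "\<And>x. (\<And>j. \<bar>x $ j - a $ j\<bar> < e) \<Longrightarrow> (\<Sum>\<alpha>\<in>S. c \<alpha> * (\<Prod>j\<in>J. (x $ j) ^ (\<alpha> $ j))) = 0"
  shows "(\<Sum>\<alpha>\<in>{\<alpha>\<in>S. \<forall>j\<in>J. \<alpha> $ j = \<beta> $ j}. c \<alpha>) = 0"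
  using assms
proof (induction J arbitrary: S rule: finite_induct)
  case empty
  from empty.prems(3)[of a] show ?case
    using \<open>0 < e\<close> by simp
next
  case (insert j J)
  \<comment> \<open>The exponents contributing to the coefficient of the \<open>k\<close>-th power
    of variable \<open>j\<close>.\<close>
  define S' where "S' k = {\<alpha>\<in>S. \<alpha> $ j = k}" for k
  have "(\<Sum>\<alpha>\<in>S' k. c \<alpha> * (\<Prod>j\<in>J. (x $ j) ^ (\<alpha> $ j))) = 0"
    if x: "\<And>j. \<bar>x $ j - a $ j\<bar> < e" for x k
  proof -
    define b where "b k = (\<Sum>\<alpha>\<in>S' k. c \<alpha> * (\<Prod>j\<in>J. (x $ j) ^ (\<alpha> $ j)))" for k
    obtain m where m: "\<And>\<alpha>. \<alpha> \<in> S \<Longrightarrow> \<alpha> $ j \<le> m"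
      using finite_nat_set_iff_bounded_le[of "(\<lambda>\<alpha>. \<alpha> $ j) ` S"] insert.prems(1) by auto
    have root: "(\<Sum>k\<le>m. b k * t ^ k) = 0" if t: "\<bar>t - a $ j\<bar> < e" for t
    proof -
      define y where "y = (\<chi> i. if i = j then t else x $ i)"
      have "0 = (\<Sum>\<alpha>\<in>S. c \<alpha> * (\<Prod>j\<in>insert j J. (y $ j) ^ (\<alpha> $ j)))"
        using insert.prems(3)[of y] x t by (simp add: y_def)
      also have "\<dots> = (\<Sum>\<alpha>\<in>S. c \<alpha> * (\<Prod>j\<in>J. (x $ j) ^ (\<alpha> $ j)) * t ^ (\<alpha> $ j))"
      proof (rule sum.cong)
        fix \<alpha>
        have "(\<Prod>j\<in>J. (y $ j) ^ (\<alpha> $ j)) = (\<Prod>j\<in>J. (x $ j) ^ (\<alpha> $ j))"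
          using insert.hyps by (intro prod.cong) (auto simp: y_def)
        then show "c \<alpha> * (\<Prod>j\<in>insert j J. (y $ j) ^ (\<alpha> $ j)) =
            c \<alpha> * (\<Prod>j\<in>J. (x $ j) ^ (\<alpha> $ j)) * t ^ (\<alpha> $ j)"
          using insert.hyps by (simp add: y_def)
      qed simp
      also have "\<dots> = (\<Sum>k\<le>m. \<Sum>\<alpha>\<in>{\<alpha>\<in>S. \<alpha> $ j = k}.
          c \<alpha> * (\<Prod>j\<in>J. (x $ j) ^ (\<alpha> $ j)) * t ^ (\<alpha> $ j))"
        using insert.prems(1) m by (intro sum.group[symmetric]) auto
      also have "\<dots> = (\<Sum>k\<le>m. b k * t ^ k)"
        by (intro sum.cong refl) (simp add: b_def S'_def sum_distrib_right)
      finally show ?thesis ..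
    qed
    have "\<not> finite {t. (\<Sum>k\<le>m. b k * t ^ k) = 0}"
    proof
      assume "finite {t. (\<Sum>k\<le>m. b k * t ^ k) = 0}"
      moreover have "{a $ j - e<..<a $ j + e} \<subseteq> {t. (\<Sum>k\<le>m. b k * t ^ k) = 0}"
        using root by (auto simp: abs_less_iff)
      ultimately have "finite {a $ j - e<..<a $ j + e}"
        by (rule finite_subset[rotated])
      then show False
        using \<open>0 < e\<close> by (simp add: infinite_Ioo)
    qed
    then have "b k = 0" if "k \<le> m" for k
      using polyfun_finite_roots[where c = b and n = m] that by blast
    moreover have "b k = 0" if "\<not> k \<le> m"
    proof -
      have "S' k = {}"
        using m that by (auto simp: S'_def)
      then show ?thesis by (simp add: b_def)
    qed
    ultimately show ?thesis
      unfolding b_def by blast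
  qed
  then have "(\<Sum>\<alpha>\<in>{\<alpha>\<in>S' (\<beta> $ j). \<forall>j\<in>J. \<alpha> $ j = \<beta> $ j}. c \<alpha>) = 0"
    using insert.prems by (intro insert.IH) (simp_all add: S'_def)
  moreover have "{\<alpha>\<in>S' (\<beta> $ j). \<forall>j\<in>J. \<alpha> $ j = \<beta> $ j} = {\<alpha>\<in>S. \<forall>j\<in>insert j J. \<alpha> $ j = \<beta> $ j}"
    by (auto simp: S'_def)
  ultimately show ?case
    by simp
qed

text \<open>With all variables in \<open>J\<close>, the class of \<open>\<beta>\<close> in the
  preceding lemma contains at most \<open>\<beta>\<close> itself, so that the class sum is a single
  coefficient.\<close>

lemma poly_zero_of_zero_on_interior:
  fixes X :: "(real ^ 'n::finite) set"
  assumes "interior X \<noteq> {}" "\<And>x. x \<in> X \<Longrightarrow> peval g x = 0"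
  shows "g = 0"
proof (rule poly_mapping_eqI)
  fix \<beta> :: "nat ^ 'n"
  obtain a r where r: "0 < r" "ball a r \<subseteq> X"
    using assms(1) by (metis ex_in_conv mem_interior)
  \<comment> \<open>Since the norm is at most the sum of the absolute coordinates, a cube of this
    half-width fits into the ball of radius \<open>r\<close>.\<close>
  define e where "e = r / real CARD('n)"
  have e: "0 < e"
    using r by (simp add: e_def)
  have "x \<in> X" if "\<And>j. \<bar>x $ j - a $ j\<bar> < e" for x
  proof -
    have "norm (x - a) \<le> (\<Sum>j\<in>UNIV. \<bar>(x - a) $ j\<bar>)"
      by (rule norm_le_l1_cart)
    also have "\<dots> < (\<Sum>j\<in>(UNIV::'n set). e)"
      using that by (intro sum_strict_mono) auto
    also have "\<dots> = r"
      by (simp add: e_def)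
    finally show ?thesis
      using r by (auto simp: dist_norm norm_minus_commute)
  qed
  then have "(\<Sum>\<alpha>\<in>Poly_Mapping.keys g. Poly_Mapping.lookup g \<alpha> * (\<Prod>j\<in>UNIV. (x $ j) ^ (\<alpha> $ j))) = 0"
    if "\<And>j. \<bar>x $ j - a $ j\<bar> < e" for x
    using assms(2)[of x] that by (simp add: peval_def monomial_def)
  then have "(\<Sum>\<alpha>\<in>{\<alpha>\<in>Poly_Mapping.keys g. \<forall>j\<in>UNIV. \<alpha> $ j = \<beta> $ j}. Poly_Mapping.lookup g \<alpha>) = 0"
    using e by (intro coeff_sums_zero_of_zero_on_box) auto
  moreover have "{\<alpha>\<in>Poly_Mapping.keys g. \<forall>j\<in>UNIV. \<alpha> $ j = \<beta> $ j} = {\<alpha>\<in>Poly_Mapping.keys g. \<alpha> = \<beta>}"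
    by (auto simp: vec_eq_iff)
  ultimately show "Poly_Mapping.lookup g \<beta> = Poly_Mapping.lookup 0 \<beta>"
    by (cases "\<beta> \<in> Poly_Mapping.keys g") (simp_all add: in_keys_iff conj_commute cong: conj_cong)
qed

text \<open>Otherwise a linear functional vanishes on all moment vectors of points of
  \<open>X\<close> but not on the unit vector. On \<open>coord_space B\<close> such a functional is
  the pairing with a polynomial, which then vanishes on \<open>X\<close> and has a non-zero
  coefficient at \<open>\<beta>\<close>.\<close>

lemma single_in_span_moment_vecs:
  fixes X :: "(real ^ 'n::finite) set"
  assumes "finite B" "interior X \<noteq> {}" "\<beta> \<in> B"
  shows "Poly_Mapping.single \<beta> 1 \<in> span (moment_vec B ` X)"
proof (rule ccontr)
  let ?W = "moment_vec B ` X" and ?s = "Poly_Mapping.single \<beta> (1::real)"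
  assume notin: "?s \<notin> span ?W"
  obtain C where C: "C \<subseteq> ?W" "independent C" "?W \<subseteq> span C"
    by (rule maximal_independent_subset)
  have "span C = span ?W"
    using C by (metis span_mono span_span subset_antisym)
  then have "?s \<notin> span C"
    using notin by simp
  then have "independent (insert ?s C)"
    using C by (simp add: independent_insertI)
  then obtain \<phi> :: "'n coords \<Rightarrow> real"
    where \<phi>: "linear \<phi>" "\<And>x. x \<in> insert ?s C \<Longrightarrow> \<phi> x = (if x = ?s then 1 else 0)"
    using linear_independent_extend[of "insert ?s C" "\<lambda>x. if x = ?s then 1 else 0 :: real"] by metis
  have "?s \<notin> C"
    using \<open>?s \<notin> span C\<close> span_base by blast
  then have "\<phi> x = 0" if "x \<in> C" for x
    using \<phi>(2)[of x] that by auto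
  then have zero: "\<phi> x = 0" if "x \<in> span C" for x
    using linear_eq_0_on_span[OF \<phi>(1)] that by blast
  \<comment> \<open>The polynomial whose coefficients are the values of \<open>\<phi>\<close> on the
    unit vectors, so that \<open>\<phi>\<close> at a moment vector is the value of \<open>g\<close>
    at the point.\<close>
  define g where "g = (coord_vec B (\<lambda>a. \<phi> (Poly_Mapping.single a 1)) :: 'n mpoly)"
  have gB: "g \<in> coord_space B"
    using assms(1) by (simp add: g_def coord_space_iff lookup_coord_vec)
  have "peval g x = 0" if "x \<in> X" for x
  proof -
    let ?w = "moment_vec B x"
    have "Poly_Mapping.single a t = t *\<^sub>R Poly_Mapping.single a (1::real)" for a :: "nat ^ 'n" and t
      by (rule poly_mapping_eqI) (simp add: lookup_single when_def)
    then have *: "\<phi> (Poly_Mapping.single a t) = t * \<phi> (Poly_Mapping.single a 1)" for a t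
      using linear_cmul[OF \<phi>(1)] by (metis real_scaleR_def)
    have "\<phi> ?w = (\<Sum>a\<in>B. \<phi> (Poly_Mapping.single a (Poly_Mapping.lookup ?w a)))"
      using sum_single_lookup[OF assms(1) moment_vec_in_coord_space[OF assms(1), of x]]
        linear_sum[OF \<phi>(1)] by metis
    also have "\<dots> = (\<Sum>a\<in>B. Poly_Mapping.lookup ?w a * \<phi> (Poly_Mapping.single a 1))"
      by (intro sum.cong refl *)
    also have "\<dots> = Lfun ?w g"
      unfolding Lfun_eq_sum[OF assms(1) gB]
      by (simp add: g_def lookup_coord_vec assms(1) mult.commute)
    also have "\<dots> = peval g x"
      by (rule Lfun_moment_vec[OF assms(1) gB])
    finally show ?thesis
      using zero C that by (metis image_subset_iff)
  qed
  then have "g = 0"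
    by (rule poly_zero_of_zero_on_interior[OF assms(2)])
  moreover have "Poly_Mapping.lookup g \<beta> = 1"
    using assms \<phi>(2)[of ?s] by (simp add: g_def lookup_coord_vec)
  ultimately show False
    by simp
qed

lemma monomial_zero_exponent [simp]: "monomial x 0 = 1"
  by (simp add: monomial_def)

section \<open>Moment cones and moment bodies\<close>

lemma convex_cone_closure: 
  fixes S :: "'a::real_normed_vector set"
  assumes "convex_cone S"
  shows "convex_cone (closure S)"
proof -
  have "c *\<^sub>R x \<in> closure S" if "x \<in> closure S" "0 \<le> c" for x c
  proof -
    have "(*\<^sub>R) c ` S \<subseteq> S"
      using assms that by (auto simp: convex_cone_scaleR)
    then have "(*\<^sub>R) c ` closure S \<subseteq> closure S"
      unfolding closure_scaleR by (rule closure_mono)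
    then show ?thesis
      using that by blast
  qed
  then show ?thesis
    using assms by (auto simp: convex_cone_def convex_closure conic_def)
qed

lemma convex_cone_hull_subset_subspace:
  "subspace S \<Longrightarrow> W \<subseteq> S \<Longrightarrow> convex_cone hull W \<subseteq> S"
  by (intro hull_minimal subspace_imp_convex_cone)

lemma moment_cone_subset_coord_space: "finite P \<Longrightarrow> moment_cone P X \<subseteq> coord_space P"
  unfolding moment_cone_def
  by (intro closure_minimal closed_coord_space convex_cone_hull_subset_subspace
      subspace_coord_space) (auto simp: moment_vec_in_coord_space)

lemma moment_vec_in_moment_cone: "x \<in> X \<Longrightarrow> moment_vec P x \<in> moment_cone P X"
  unfolding moment_cone_def using closure_subset hull_inc by (metis imageI subsetD)

text \<open>The half-space defined by \<open>g\<close> is a closed convex cone containing the moment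
  vectors.\<close>

lemma Lfun_moment_cone_nonneg:
  assumes "finite P" "g \<in> nonneg_polys P X" "y \<in> moment_cone P X"
  shows "0 \<le> Lfun y g"
proof -
  have g: "g \<in> coord_space P" "\<And>x. x \<in> X \<Longrightarrow> 0 \<le> peval g x"
    using assms by (auto simp: nonneg_polys_def poly_space_eq_coord_space)
  have "convex_cone hull (moment_vec P ` X) \<subseteq> {y. 0 \<le> Lfun y g}"
    using g by (intro hull_minimal)
      (auto simp: Lfun_moment_vec[OF assms(1)] convex_cone_iff Lfun_simps)
  moreover have "closed {y. 0 \<le> Lfun y g}"
    by (intro closed_Collect_le continuous_on_const
        bounded_linear.continuous_on[OF bounded_linear_Lfun_left] continuous_on_id)
  ultimately have "moment_cone P X \<subseteq> {y. 0 \<le> Lfun y g}"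
    unfolding moment_cone_def by (rule closure_minimal)
  with assms show ?thesis by auto
qed

text \<open>Bipolar argument: a vector separating \<open>y\<close> from the cone, read as a
  polynomial, is non-negative on \<open>X\<close> because its values are pairings with moment
  vectors, yet it is negative on \<open>y\<close>.\<close>

lemma moment_cone_dual:
  assumes "finite P" "y \<in> coord_space P" "\<And>g. g \<in> nonneg_polys P X \<Longrightarrow> 0 \<le> Lfun y g"
  shows "y \<in> moment_cone P X"
proof (rule ccontr)
  assume "y \<notin> moment_cone P X"
  moreover have "closed (moment_cone P X)" "convex_cone (moment_cone P X)"
    by (simp_all add: moment_cone_def convex_cone_closure convex_cone_convex_cone_hull)
  ultimately obtain g where g: "g \<in> coord_space P" "\<And>z. z \<in> moment_cone P X \<Longrightarrow> 0 \<le> Lfun g z" "Lfun g y < 0"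
    using separate_closed_convex_cone[OF assms(1)] assms moment_cone_subset_coord_space by metis
  have "0 \<le> peval g x" if "x \<in> X" for x
    using g(2)[OF moment_vec_in_moment_cone[OF that]] Lfun_moment_vec[OF assms(1) g(1)]
    by (simp add: Lfun_commute[of g])
  then have "g \<in> nonneg_polys P X"
    using g by (simp add: nonneg_polys_def poly_space_eq_coord_space)
  then show False
    using assms(3) g(3) by (force simp: Lfun_commute[of g])
qed

lemma const_poly_nonneg: "0 \<in> P \<Longrightarrow> 0 \<le> c \<Longrightarrow> const_poly c \<in> nonneg_polys P X"
  by (auto simp: nonneg_polys_def poly_space_def const_poly_def peval_def)

lemma moment_cone_lookup_zero_nonneg:
  "finite P \<Longrightarrow> 0 \<in> P \<Longrightarrow> y \<in> moment_cone P X \<Longrightarrow> 0 \<le> Poly_Mapping.lookup y 0"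
  using Lfun_moment_cone_nonneg[OF _ const_poly_nonneg[of P 1 X]] by simp

lemma moment_body_lookup_zero:
  assumes "finite P" "0 \<in> P" "y \<in> moment_body P X"
  shows "Poly_Mapping.lookup y 0 = 1"
proof -
  have "moment_body P X \<subseteq> {y. Poly_Mapping.lookup y 0 = 1}"
    unfolding moment_body_def using assms
    by (intro hull_minimal) (auto simp: lookup_moment_vec convex_alt lookup_add)
  with assms show ?thesis by auto
qed

text \<open>Every point of the convex hull has zero coordinate 1, so a scalar multiple of one with
  zero coordinate 1 must have factor 1. The cone here is the hull before closure.\<close>

lemma moment_body_iff_convex_cone_hull:
  assumes "finite P" "0 \<in> P"
  shows "y \<in> moment_body P X \<longleftrightarrow>
    y \<in> convex_cone hull (moment_vec P ` X) \<and> Poly_Mapping.lookup y 0 = 1"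
proof safe
  assume y: "y \<in> moment_body P X"
  then show "y \<in> convex_cone hull (moment_vec P ` X)"
    using convex_hull_subset_convex_cone_hull by (auto simp: moment_body_def)
  show "Poly_Mapping.lookup y 0 = 1"
    using moment_body_lookup_zero[OF assms y] .
next
  assume "y \<in> convex_cone hull (moment_vec P ` X)" and y0: "Poly_Mapping.lookup y 0 = 1"
  then obtain c x where "x \<in> moment_body P X" "y = c *\<^sub>R x"
    by (auto simp: convex_cone_hull_convex_hull moment_body_def)
  then show "y \<in> moment_body P X"
    using moment_body_lookup_zero[OF assms, of x X] y0 by simp
qed

lemma sum_in_convex_cone:
  assumes "convex_cone K" "finite I" "\<And>i. i \<in> I \<Longrightarrow> f i \<in> K"
  shows "(\<Sum>i\<in>I. f i) \<in> K"
  using assms(2,3)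
  by (induction I rule: finite_induct)
    (auto simp: assms(1) convex_cone_contains_0 convex_cone_add)

text \<open>A moment functional in the interior of all the moment cones simultaneously. The vectors \<open>d\<close>
  such that \<open>v + d\<close> and \<open>v - d\<close> lie in the cone for some \<open>v\<close> form a subspace, hence include every
  coordinate direction; adding up the witnesses \<open>v\<close> for these gives an interior point.\<close>

lemma interior_moment_functional:
  fixes X :: "(real ^ 'n::finite) set" and B :: "(nat ^ 'n) set"
  assumes "finite B" "0 \<in> B" "interior X \<noteq> {}"
  obtains v r where "0 < r" "v \<in> coord_space B" "Poly_Mapping.lookup v 0 = 1"
    "\<And>P u. P \<subseteq> B \<Longrightarrow> u \<in> coord_box P r \<Longrightarrow>
      restrict_coords P v + u \<in> convex_cone hull (moment_vec P ` X)"
proof -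
  let ?K = "convex_cone hull (moment_vec B ` X)"
  let ?S = "{d. \<exists>v. v + d \<in> ?K \<and> v - d \<in> ?K}"
  let ?s = "\<lambda>a. Poly_Mapping.single a (1::real)"
  have K: "convex_cone ?K"
    by (rule convex_cone_convex_cone_hull)
  have KB: "?K \<subseteq> coord_space B"
    using assms(1) by (intro convex_cone_hull_subset_subspace subspace_coord_space)
      (auto simp: moment_vec_in_coord_space)
  have "subspace ?S"
  proof (rule subspaceI)
    show "0 \<in> ?S"
      using convex_cone_contains_0[OF K] by (auto intro!: exI[of _ 0])
  next
    fix d e assume "d \<in> ?S" "e \<in> ?S"
    then obtain v w where "v + d \<in> ?K" "v - d \<in> ?K" "w + e \<in> ?K" "w - e \<in> ?K"
      by auto
    then have "(v + d) + (w + e) \<in> ?K" "(v - d) + (w - e) \<in> ?K"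
      by (simp_all add: convex_cone_add[OF K])
    then show "d + e \<in> ?S"
      by (auto intro!: exI[of _ "v + w"] simp: algebra_simps)
  next
    fix c :: real and d assume "d \<in> ?S"
    then obtain v where "v + d \<in> ?K" "v - d \<in> ?K"
      by auto
    then have "\<bar>c\<bar> *\<^sub>R (v + d) \<in> ?K" "\<bar>c\<bar> *\<^sub>R (v - d) \<in> ?K"
      by (simp_all add: convex_cone_scaleR[OF K])
    \<comment> \<open>For negative \<open>c\<close> the two memberships swap roles.\<close>
    then have "\<bar>c\<bar> *\<^sub>R v + c *\<^sub>R d \<in> ?K \<and> \<bar>c\<bar> *\<^sub>R v - c *\<^sub>R d \<in> ?K"
      by (cases "0 \<le> c") (simp_all add: scaleR_add_right scaleR_diff_right)
    then show "c *\<^sub>R d \<in> ?S"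
      by blast
  qed
  moreover have "moment_vec B ` X \<subseteq> ?S"
  proof
    fix w assume "w \<in> moment_vec B ` X"
    then have "w \<in> ?K"
      by (rule hull_inc)
    then have "w + w \<in> ?K" and "w - w \<in> ?K"
      by (simp_all only: convex_cone_add[OF K] diff_self convex_cone_contains_0[OF K])
    then show "w \<in> ?S"
      by blast
  qed
  ultimately have "span (moment_vec B ` X) \<subseteq> ?S"
    by (rule span_minimal[rotated])
  then have "\<forall>a\<in>B. \<exists>v. v + ?s a \<in> ?K \<and> v - ?s a \<in> ?K"
    using single_in_span_moment_vecs[OF assms(1,3)] by auto
  then obtain w where w: "\<And>a. a \<in> B \<Longrightarrow> w a + ?s a \<in> ?K" "\<And>a. a \<in> B \<Longrightarrow> w a - ?s a \<in> ?K"
    by metis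
  define v1 where "v1 = (\<Sum>a\<in>B. w a)"
  have box: "v1 + u \<in> ?K" if u: "u \<in> coord_box B 1" for u
  proof -
    have "w a + Poly_Mapping.single a (Poly_Mapping.lookup u a) \<in> ?K" if "a \<in> B" for a
    proof -
      define t where "t = Poly_Mapping.lookup u a"
      have t: "\<bar>t\<bar> \<le> 1"
        using u by (simp add: coord_box_def t_def)
      \<comment> \<open>A convex combination of the two witnesses reaches every shift by
        \<open>t\<close> between -1 and 1.\<close>
      have "((1 + t) / 2) *\<^sub>R (w a + ?s a) + ((1 - t) / 2) *\<^sub>R (w a - ?s a) \<in> ?K"
        using t by (intro convex_cone_add[OF K convex_cone_scaleR[OF K _ w(1)[OF that]]
            convex_cone_scaleR[OF K _ w(2)[OF that]]]) auto
      also have "((1 + t) / 2) *\<^sub>R (w a + ?s a) + ((1 - t) / 2) *\<^sub>R (w a - ?s a) =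
          w a + Poly_Mapping.single a t"
        by (intro poly_mapping_eqI)
          (simp add: lookup_add lookup_minus lookup_single when_def field_simps)
      finally show ?thesis
        by (simp add: t_def)
    qed
    then have "(\<Sum>a\<in>B. w a + Poly_Mapping.single a (Poly_Mapping.lookup u a)) \<in> ?K"
      by (intro sum_in_convex_cone[OF K assms(1)])
    then show ?thesis
      using u assms(1) by (simp add: sum.distrib v1_def sum_single_lookup coord_box_def)
  qed
  define s where "s = Poly_Mapping.lookup v1 0"
  \<comment> \<open>The shift by the negative unit vector at 0 still lies in the cone, whose
    elements have non-negative zero coordinate. This gives \<open>1 \<le> s\<close> and allows
    normalisation by \<open>s\<close>.\<close>
  have "- ?s 0 \<in> coord_box B 1"
    using assms(2) by (auto simp: coord_box_def coord_space_iff lookup_one when_def)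
  from box[OF this] have "v1 - ?s 0 \<in> moment_cone B X"
    unfolding moment_cone_def using closure_subset by auto
  then have s: "1 \<le> s"
    using moment_cone_lookup_zero_nonneg[OF assms(1,2), of "v1 - ?s 0" X]
    by (simp add: s_def lookup_minus)
  have "0 \<in> coord_box B 1"
    by (auto simp: coord_box_def coord_space_iff)
  from box[OF this] have v1: "v1 \<in> coord_space B"
    using KB by auto
  have scaled: "(1 / s) *\<^sub>R v1 + u \<in> ?K" if u: "u \<in> coord_box B (1 / s)" for u
  proof -
    have "\<bar>s * Poly_Mapping.lookup u a\<bar> \<le> 1" for a
      using u s by (auto simp: coord_box_def abs_mult field_simps)
    then have "s *\<^sub>R u \<in> coord_box B 1"
      using u by (auto simp: coord_box_def coord_space_iff)
    then have "(1 / s) *\<^sub>R (v1 + s *\<^sub>R u) \<in> ?K"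
      using s by (intro convex_cone_scaleR[OF K] box) auto
    then show ?thesis
      using s by (simp add: scaleR_add_right)
  qed
  show ?thesis
  proof (rule that[of "1 / s" "(1 / s) *\<^sub>R v1"])
    show "(1 / s) *\<^sub>R v1 \<in> coord_space B"
      using v1 by (intro subspace_scale subspace_coord_space)
    show "Poly_Mapping.lookup ((1 / s) *\<^sub>R v1) 0 = 1"
      using s by (simp flip: s_def)
    fix P u assume P: "P \<subseteq> B" and u: "u \<in> coord_box P (1 / s)"
    have fP: "finite P"
      using P assms(1) by (rule finite_subset)
    note lin = bounded_linear.linear[OF bounded_linear_restrict_coords[OF fP]]
    have "u \<in> coord_box B (1 / s)"
      using u P by (auto simp: coord_box_def coord_space_iff)
    then have "restrict_coords P ((1 / s) *\<^sub>R v1 + u) \<in> restrict_coords P ` ?K"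
      by (intro imageI scaled)
    \<comment> \<open>Restriction is linear and maps moment vectors over \<open>B\<close> to those
      over \<open>P\<close>, so one \<open>v\<close> and one radius serve all \<open>P\<close> at
      once.\<close>
    also have "restrict_coords P ` ?K = convex_cone hull (moment_vec P ` X)"
      using P assms(1) by (simp add: convex_cone_hull_linear_image[OF lin, symmetric] image_image
          restrict_moment_vec)
    also have "restrict_coords P ((1 / s) *\<^sub>R v1 + u) = restrict_coords P ((1 / s) *\<^sub>R v1) + restrict_coords P u"
      by (rule linear_add[OF lin])
    also have "restrict_coords P u = u"
      using u fP by (intro poly_mapping_eqI)
        (auto simp: lookup_restrict_coords coord_box_def coord_space_iff)
    finally show "restrict_coords P ((1 / s) *\<^sub>R v1) + u \<in> convex_cone hull (moment_vec P ` X)" .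
  qed (use s in auto)
qed

text \<open>Perturbing \<open>v\<close> by \<open>t\<close> in coordinate \<open>a\<close> stays in
  the cone, so \<open>Lfun v g\<close> plus \<open>t\<close> times the coefficient is non-negative;
  take \<open>t\<close> to be \<open>r\<close> and \<open>- r\<close>.\<close>

lemma interior_functional_coeff_bound:
  assumes "finite P" "0 < r" "g \<in> nonneg_polys P X"
    and "\<And>u. u \<in> coord_box P r \<Longrightarrow> restrict_coords P v + u \<in> convex_cone hull (moment_vec P ` X)"
  shows "r * \<bar>Poly_Mapping.lookup g a\<bar> \<le> Lfun v g"
proof -
  have g: "g \<in> coord_space P"
    using assms by (simp add: nonneg_polys_def poly_space_eq_coord_space)
  have *: "- t * Poly_Mapping.lookup g a \<le> Lfun v g" if "\<bar>t\<bar> \<le> r" for t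
  proof (cases "a \<in> P")
    case True
    then have "Poly_Mapping.single a t \<in> coord_box P r"
      using that assms(2) by (auto simp: coord_box_def coord_space_iff lookup_single when_def)
    from assms(4)[OF this]
    have "restrict_coords P v + Poly_Mapping.single a t \<in> moment_cone P X"
      unfolding moment_cone_def using closure_subset by auto
    from Lfun_moment_cone_nonneg[OF assms(1,3) this] show ?thesis
      by (simp add: Lfun_simps Lfun_restrict_coords[OF assms(1) g]
          Lfun_commute[of "Poly_Mapping.single a t"])
  next
    case False
    have "0 \<in> coord_box P r"
      using assms(2) by (auto simp: coord_box_def coord_space_iff)
    from assms(4)[OF this]
    have "restrict_coords P v \<in> moment_cone P X"
      unfolding moment_cone_def using closure_subset by auto
    from Lfun_moment_cone_nonneg[OF assms(1,3) this] show ?thesis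
      using False g by (simp add: Lfun_restrict_coords[OF assms(1) g] coord_space_iff)
  qed
  show ?thesis
    using *[of r] *[of "-r"] assms(2) by (cases "0 \<le> Poly_Mapping.lookup g a") auto
qed

section \<open>Closedness of the sum of the cones of non-negative polynomials\<close>

lemma peval_zero [simp]: "peval 0 x = 0"
  by (simp add: peval_def)

lemma peval_add: "peval (g + h) x = peval g x + peval h x"
proof -
  let ?B = "Poly_Mapping.keys g \<union> Poly_Mapping.keys h"
  have "g \<in> coord_space ?B" "h \<in> coord_space ?B" and B: "finite ?B"
    by (auto simp: coord_space_def)
  then show ?thesis
    by (simp add: Lfun_moment_vec[OF B, symmetric] subspace_add subspace_coord_space Lfun_simps)
qed

lemma peval_scaleR: "peval (c *\<^sub>R g) x = c * peval g x"
proof -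
  have "g \<in> coord_space (Poly_Mapping.keys g)" and B: "finite (Poly_Mapping.keys g)"
    by (auto simp: coord_space_def)
  then show ?thesis
    by (simp add: Lfun_moment_vec[OF B, symmetric] subspace_scale subspace_coord_space Lfun_simps)
qed

lemma convex_cone_nonneg_polys: "convex_cone (nonneg_polys P X)"
  by (auto simp: convex_cone_iff nonneg_polys_def poly_space_eq_coord_space subspace_0
      subspace_add subspace_scale subspace_coord_space peval_add peval_scaleR)

lemma closed_nonneg_polys:
  assumes "finite P"
  shows "closed (nonneg_polys P X)"
proof -
  have "nonneg_polys P X = coord_space P \<inter> (\<Inter>x\<in>X. {g. 0 \<le> Lfun (moment_vec P x) g})"
    by (auto simp: nonneg_polys_def poly_space_eq_coord_space Lfun_moment_vec[OF assms])
  then show ?thesis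
    by (auto intro!: closed_Int closed_coord_space closed_INT closed_Collect_le continuous_on_const
        bounded_linear.continuous_on[OF bounded_linear_Lfun_right] continuous_on_id)
qed

lemma convex_cone_set_sum:
  assumes "finite I" "\<And>i. i \<in> I \<Longrightarrow> convex_cone (S i)"
  shows "convex_cone (\<Sum>i\<in>I. S i)"
  using assms
proof (induction I rule: finite_induct)
  case empty
  show ?case by (simp add: set_zero)
next
  case (insert i I)
  have "S i + (\<Sum>i\<in>I. S i) = (\<Union>x\<in>S i. \<Union>y\<in>(\<Sum>i\<in>I. S i). {x + y})"
    by (auto simp: set_plus_def)
  then show ?case
    using insert by (simp add: convex_cone_sums)
qed

text \<open>A Minkowski sum of closed cones can fail to be closed because summands may cancel at
  infinity. The interior functional \<open>v\<close> excludes this: \<open>Lfun v\<close> is bounded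
  along a convergent sequence, hence so are the coefficients of all summands, and the sequence stays
  in one compact set \<open>T R\<close>.\<close>

lemma closed_sum_nonneg_polys:
  fixes X :: "(real ^ 'n::finite) set"
  assumes "finite I" "\<And>i. i \<in> I \<Longrightarrow> finite (P i)" "0 \<in> (\<Union>i\<in>I. P i)" "interior X \<noteq> {}"
  shows "closed (\<Sum>i\<in>I. nonneg_polys (P i) X)"
proof -
  let ?B = "\<Union>i\<in>I. P i" and ?K = "\<Sum>i\<in>I. nonneg_polys (P i) X"
  have "finite ?B"
    using assms by auto
  then obtain v r where r: "0 < r" and v: "\<And>P u. P \<subseteq> ?B \<Longrightarrow> u \<in> coord_box P r \<Longrightarrow>
      restrict_coords P v + u \<in> convex_cone hull (moment_vec P ` X)"
    using interior_moment_functional[of ?B X] assms by metis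
  have bound: "r * \<bar>Poly_Mapping.lookup g a\<bar> \<le> Lfun v g" if "i \<in> I" "g \<in> nonneg_polys (P i) X" for g a i
    using that assms r by (intro interior_functional_coeff_bound[of "P i" r g X]) (auto intro!: v)
  define T where "T R = (\<Sum>i\<in>I. nonneg_polys (P i) X \<inter> coord_box (P i) R)" for R
  have "compact (T R)" for R
    unfolding T_def using assms(1,2)
    by (intro compact_set_sum closed_Int_compact closed_nonneg_polys compact_coord_box)
  then have closedT: "closed (T R)" for R
    by (rule compact_imp_closed)
  have TK: "T R \<subseteq> ?K" for R
    by (auto simp: T_def set_sum_alt[OF assms(1)])
  have KT: "g \<in> T R" if g: "g \<in> ?K" "Lfun v g \<le> r * R" for g R
  proof -
    obtain h where h: "g = sum h I" "\<And>i. i \<in> I \<Longrightarrow> h i \<in> nonneg_polys (P i) X"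
      using g(1) unfolding set_sum_alt[OF assms(1)] by auto
    have "h i \<in> coord_box (P i) R" if i: "i \<in> I" for i
    proof -
      have "\<bar>Poly_Mapping.lookup (h i) a\<bar> \<le> R" for a
      proof -
        have "r * \<bar>Poly_Mapping.lookup (h i) a\<bar> \<le> Lfun v (h i)"
          using bound i h(2) by blast
        \<comment> \<open>All summands have non-negative value under \<open>Lfun v\<close>, so one
          of them is bounded by the total.\<close>
        also have "\<dots> \<le> (\<Sum>i\<in>I. Lfun v (h i))"
        proof (rule member_le_sum)
          show "0 \<le> Lfun v (h j)" if "j \<in> I - {i}" for j
            using bound[of j "h j" 0] h(2)[of j] that r
            by (metis DiffD1 abs_ge_zero less_imp_le mult_nonneg_nonneg order_trans)
        qed (use i assms in auto)
        also have "\<dots> = Lfun v g"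
          by (simp add: h(1) linear_sum[OF bounded_linear.linear[OF bounded_linear_Lfun_right]])
        also have "\<dots> \<le> r * R" by fact
        finally show ?thesis
          using r by simp
      qed
      then show ?thesis
        using h(2)[OF i] by (simp add: coord_box_def nonneg_polys_def poly_space_eq_coord_space)
    qed
    then show ?thesis
      using h unfolding T_def set_sum_alt[OF assms(1)] by auto
  qed
  show ?thesis
    unfolding closed_sequential_limits
  proof safe
    fix g l assume g: "\<forall>n. g n \<in> ?K" and lim: "g \<longlonglongrightarrow> l"
    have "(\<lambda>n. Lfun v (g n)) \<longlonglongrightarrow> Lfun v l"
      by (rule bounded_linear.tendsto[OF bounded_linear_Lfun_right lim])
    then have "Bseq (\<lambda>n. Lfun v (g n))"
      by (rule convergentI[THEN convergent_imp_Bseq])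
    then obtain C where C: "\<And>n. \<bar>Lfun v (g n)\<bar> \<le> C"
      by (auto simp: Bseq_def)
    have "g n \<in> T (C / r)" for n
      using C[of n] r g by (intro KT) auto
    then have "l \<in> T (C / r)"
      using closed_sequentially[OF closedT] lim by blast
    then show "l \<in> ?K"
      using TK by blast
  qed
qed

section \<open>Approximation by moment bodies and their compactness\<close>

text \<open>The point \<open>y\<close> lies only in the closure of the hull. A nearby
  \<open>z\<close> in the hull replaces it, and the error is absorbed by the box around
  \<open>w\<close>.\<close>

lemma interior_shift_in_moment_body:
  assumes P: "finite P" "0 \<in> P" and r: "0 < r"
    and w: "Poly_Mapping.lookup w 0 = 1"
      "\<And>u. u \<in> coord_box P r \<Longrightarrow> w + u \<in> convex_cone hull (moment_vec P ` X)"
    and y: "y \<in> moment_cone P X" "Poly_Mapping.lookup y 0 = 1"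
    and e: "0 < e" "e < 1"
  shows "(1 - e) *\<^sub>R y + e *\<^sub>R w \<in> moment_body P X"
proof -
  let ?K = "convex_cone hull (moment_vec P ` X)"
  have K: "convex_cone ?K"
    by (rule convex_cone_convex_cone_hull)
  obtain z where z: "z \<in> ?K" "dist z y < e * r"
    using y(1) e r unfolding moment_cone_def closure_approachable by (metis mult_pos_pos)
  have "z \<in> moment_cone P X"
    using z closure_subset unfolding moment_cone_def by blast
  then have "z \<in> coord_space P" "y \<in> coord_space P"
    using y moment_cone_subset_coord_space[OF P(1)] by blast+
  \<comment> \<open>Chosen so that \<open>(1 - e) *\<^sub>R z + e *\<^sub>R (w + u)\<close> equals
    the target; closeness within \<open>e * r\<close> keeps \<open>u\<close> in the box of radius
    \<open>r\<close>.\<close>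
  moreover define u where "u = ((1 - e) / e) *\<^sub>R (y - z)"
  ultimately have "u \<in> coord_space P"
    by (simp add: subspace_diff subspace_scale subspace_coord_space)
  moreover have "\<bar>Poly_Mapping.lookup u a\<bar> \<le> r" for a
  proof -
    have "\<bar>Poly_Mapping.lookup u a\<bar> \<le> norm u"
      using norm_lookup_le[of u a] by simp
    also have "\<dots> = (1 - e) / e * dist z y"
      using e by (simp add: u_def dist_norm norm_minus_commute)
    also have "\<dots> \<le> 1 / e * (e * r)"
      using e z by (intro mult_mono divide_right_mono) auto
    also have "\<dots> = r"
      using e by simp
    finally show ?thesis .
  qed
  ultimately have "w + u \<in> ?K"
    by (intro w) (simp add: coord_box_def)
  then have "(1 - e) *\<^sub>R z + e *\<^sub>R (w + u) \<in> ?K"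
    using e by (intro convex_cone_add[OF K convex_cone_scaleR[OF K _ z(1)]
        convex_cone_scaleR[OF K]]) auto
  also have "(1 - e) *\<^sub>R z + e *\<^sub>R (w + u) = (1 - e) *\<^sub>R y + e *\<^sub>R w"
    using e by (simp add: u_def scaleR_add_right scaleR_diff_right)
  finally show ?thesis
    using y w by (simp add: moment_body_iff_convex_cone_hull[OF P] lookup_add)
qed

lemma coord_space_subset_span:
  assumes "finite P"
  shows "coord_space P \<subseteq> span ((\<lambda>a. Poly_Mapping.single a 1) ` P)"
proof
  fix v :: "'a coords" assume v: "v \<in> coord_space P"
  have "(\<Sum>a\<in>P. Poly_Mapping.lookup v a *\<^sub>R Poly_Mapping.single a 1) \<in>
      span ((\<lambda>a. Poly_Mapping.single a 1) ` P)"
    by (intro span_sum span_scale span_base imageI)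
  also have "(\<Sum>a\<in>P. Poly_Mapping.lookup v a *\<^sub>R Poly_Mapping.single a 1) =
      (\<Sum>a\<in>P. Poly_Mapping.single a (Poly_Mapping.lookup v a))"
    by (intro sum.cong refl poly_mapping_eqI) (simp add: lookup_single when_def)
  also have "\<dots> = v"
    by (rule sum_single_lookup[OF assms v])
  finally show "v \<in> span ((\<lambda>a. Poly_Mapping.single a 1) ` P)" .
qed

text \<open>A linear dependency among more than \<open>card P\<close> vectors permits removing one
  of them without changing the combination. Only non-negativity of the weights is preserved, not
  their sum, so the bound is the dimension rather than the dimension plus one.\<close>

lemma conic_caratheodory:
  assumes "finite P" "finite T" "T \<subseteq> coord_space P" "\<And>v. v \<in> T \<Longrightarrow> 0 \<le> u v"
  shows "\<exists>T' u'. T' \<subseteq> T \<and> card T' \<le> card P \<and> (\<forall>v\<in>T'. 0 \<le> u' v) \<and>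
    (\<Sum>v\<in>T'. u' v *\<^sub>R v) = (\<Sum>v\<in>T. u v *\<^sub>R v)"
  using assms(2-)
proof (induction "card T" arbitrary: T u rule: less_induct)
  case less
  show ?case
  proof (cases "card T \<le> card P")
    case True
    then show ?thesis
      using less.prems by blast
  next
    case False
    have "\<not> independent T"
    proof
      assume "independent T"
      then have "card T \<le> card ((\<lambda>a. Poly_Mapping.single a (1::real)) ` P)"
        using assms(1) less.prems coord_space_subset_span[OF assms(1)]
        by (intro independent_span_bound[THEN conjunct2]) auto
      then show False
        using False card_image_le[OF assms(1)] by (metis order_trans)
    qed
    then obtain c0 where c0: "\<exists>v\<in>T. c0 v \<noteq> 0" "(\<Sum>v\<in>T. c0 v *\<^sub>R v) = 0"
      using dependent_finite[OF less.prems(1)] by auto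
    obtain c where c: "\<exists>v\<in>T. 0 < c v" "(\<Sum>v\<in>T. c v *\<^sub>R v) = 0"
    proof (cases "\<exists>v\<in>T. 0 < c0 v")
      case True
      with c0 that show ?thesis by blast
    next
      case False
      then have "\<exists>v\<in>T. 0 < - c0 v"
        using c0(1) by (metis neg_0_less_iff_less linorder_neqE_linordered_idom)
      moreover have "(\<Sum>v\<in>T. (- c0 v) *\<^sub>R v) = 0"
        using c0(2) by (simp add: sum_negf)
      ultimately show ?thesis
        by (rule that)
    qed
    define S where "S = {v \<in> T. 0 < c v}"
    have "finite S" "S \<noteq> {}"
      using c less.prems by (auto simp: S_def)
    then obtain w where w: "w \<in> S" "\<And>v. v \<in> S \<Longrightarrow> u w / c w \<le> u v / c v"
      using ex_min_if_finite[of "(\<lambda>v. u v / c v) ` S"] by (auto simp: not_less)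
    \<comment> \<open>The largest multiple of the dependency that can be subtracted with all weights
      staying non-negative; the weight of \<open>w\<close> becomes 0.\<close>
    define t where "t = u w / c w"
    have wT: "w \<in> T" "0 < c w"
      using w by (auto simp: S_def)
    then have t: "0 \<le> t"
      using less.prems by (simp add: t_def)
    define u1 where "u1 v = u v - t * c v" for v
    have u1: "0 \<le> u1 v" if "v \<in> T" for v
    proof (cases "0 < c v")
      case True
      then have "t \<le> u v / c v"
        using w(2)[of v] that by (simp add: S_def t_def)
      then show ?thesis
        using True by (simp add: u1_def field_simps)
    next
      case False
      then have "t * c v \<le> 0"
        using t by (simp add: mult_nonneg_nonpos)
      then show ?thesis
        using less.prems(3)[OF that] by (simp add: u1_def)
    qed
    have "u1 w = 0"
      using wT by (simp add: u1_def t_def)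
    then have "(\<Sum>v\<in>T - {w}. u1 v *\<^sub>R v) = (\<Sum>v\<in>T. u1 v *\<^sub>R v)"
      using less.prems wT by (simp add: sum.remove[of T w])
    also have "\<dots> = (\<Sum>v\<in>T. u v *\<^sub>R v) - t *\<^sub>R (\<Sum>v\<in>T. c v *\<^sub>R v)"
      by (simp add: u1_def scaleR_diff_left sum_subtractf scaleR_sum_right)
    finally have sum: "(\<Sum>v\<in>T - {w}. u1 v *\<^sub>R v) = (\<Sum>v\<in>T. u v *\<^sub>R v)"
      using c by simp
    have "card (T - {w}) < card T"
      using wT less.prems by (metis card_Diff1_less)
    from less.hyps[OF this, of u1] obtain T' u' where "T' \<subseteq> T - {w}" "card T' \<le> card P"
      "\<forall>v\<in>T'. 0 \<le> u' v" "(\<Sum>v\<in>T'. u' v *\<^sub>R v) = (\<Sum>v\<in>T - {w}. u1 v *\<^sub>R v)"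
      using less.prems u1 by auto
    then show ?thesis
      using sum by (metis Diff_subset order_trans)
  qed
qed

lemma continuous_on_moment_vec: "continuous_on X (moment_vec P)"
  unfolding moment_vec_def coord_vec_def monomial_def
  by (intro continuous_on_sum bounded_linear.continuous_on[OF bounded_linear_single]
      continuous_on_prod continuous_on_power continuous_on_component continuous_on_id)

text \<open>By Caratheodory a fixed number of summands suffices, so the body is the slice at zero
  coordinate 1 of the compact set \<open>Z\<close>.\<close>

lemma compact_moment_body:
  assumes P: "finite P" "0 \<in> P" and "compact X"
  shows "compact (moment_body P X)"
proof (cases "X = {}")
  case False
  define W where "W = moment_vec P ` X"
  define Z where "Z = (\<Sum>i\<in>{..<card P}. (\<lambda>(t, w). t *\<^sub>R w) ` ({0..1::real} \<times> W))"
  have W: "W \<subseteq> coord_space P" "\<And>w. w \<in> W \<Longrightarrow> Poly_Mapping.lookup w 0 = 1"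
    using P by (auto simp: W_def moment_vec_in_coord_space lookup_moment_vec)
  have "compact W"
    unfolding W_def using assms by (intro compact_continuous_image continuous_on_moment_vec)
  then have Z: "compact Z"
    unfolding Z_def
    by (intro compact_set_sum compact_continuous_image compact_Times)
      (auto simp: case_prod_unfold intro!: continuous_intros)
  have "moment_body P X = Z \<inter> {y. Poly_Mapping.lookup y 0 = 1}"
  proof (intro equalityI subsetI)
    fix y assume y: "y \<in> Z \<inter> {y. Poly_Mapping.lookup y 0 = 1}"
    then obtain s where s: "y = (\<Sum>i<card P. s i)"
      "\<And>i. i < card P \<Longrightarrow> s i \<in> (\<lambda>(t, w). t *\<^sub>R w) ` ({0..1::real} \<times> W)"
      unfolding Z_def set_sum_alt[OF finite_lessThan] by auto
    have "s i \<in> convex_cone hull W" if "i < card P" for i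
      using s(2)[OF that] by (auto intro!: convex_cone_hull_mul simp: hull_inc)
    then have "y \<in> convex_cone hull W"
      unfolding s(1) by (intro sum_in_convex_cone convex_cone_convex_cone_hull) auto
    with y show "y \<in> moment_body P X"
      by (simp add: moment_body_iff_convex_cone_hull[OF P] W_def)
  next
    fix y assume y: "y \<in> moment_body P X"
    then have y0: "Poly_Mapping.lookup y 0 = 1"
      by (rule moment_body_lookup_zero[OF P])
    have "y \<in> convex hull W"
      using y by (simp only: moment_body_def W_def)
    then obtain T0 u0 where T0: "finite T0" "T0 \<subseteq> W" "\<forall>v\<in>T0. 0 \<le> u0 v"
      "(\<Sum>v\<in>T0. u0 v *\<^sub>R v) = y"
      by (force simp only: convex_hull_explicit)
    then obtain T u where T: "T \<subseteq> W" "finite T" "card T \<le> card P" "\<And>v. v \<in> T \<Longrightarrow> 0 \<le> u v"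
      "(\<Sum>v\<in>T. u v *\<^sub>R v) = y"
      using conic_caratheodory[OF P(1) T0(1), of u0] W(1) by (blast dest: finite_subset)
    \<comment> \<open>The zero coordinate of the combination recovers the total weight, so each
      weight is at most 1 as \<open>Z\<close> demands.\<close>
    have "(\<Sum>v\<in>T. u v) = (\<Sum>v\<in>T. u v * Poly_Mapping.lookup v 0)"
      using T W by (intro sum.cong) auto
    also have "\<dots> = Poly_Mapping.lookup y 0"
      by (simp add: lookup_sum flip: T(5))
    finally have "(\<Sum>v\<in>T. u v) = 1"
      using y0 by simp
    then have u1: "u v \<le> 1" if "v \<in> T" for v
      using member_le_sum[of v T u] T that by auto
    obtain h where h: "bij_betw h {..<card T} T"
      using ex_bij_betw_nat_finite[OF T(2)] by (auto simp: atLeast0LessThan)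
    obtain w0 where w0: "w0 \<in> W"
      using False by (auto simp: W_def)
    \<comment> \<open>If \<open>T\<close> has fewer than \<open>card P\<close> elements, the sum is
      padded with zeros; each is 0 times the arbitrary \<open>w0\<close>.\<close>
    define s where "s i = (if i < card T then u (h i) *\<^sub>R h i else 0)" for i
    have "(\<Sum>i<card P. s i) = (\<Sum>i<card T. u (h i) *\<^sub>R h i)"
      using T(3) by (intro sum.mono_neutral_cong_right) (auto simp: s_def)
    also have "\<dots> = y"
      using sum.reindex_bij_betw[OF h, of "\<lambda>v. u v *\<^sub>R v"] T(5) by simp
    finally have "y = (\<Sum>i<card P. s i)" ..
    moreover have "s i \<in> (\<lambda>(t, w). t *\<^sub>R w) ` ({0..1::real} \<times> W)" for i
    proof (cases "i < card T")
      case True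
      then have "h i \<in> T"
        using h by (auto simp: bij_betw_def)
      then show ?thesis
        using True T u1 by (intro image_eqI[of _ _ "(u (h i), h i)"]) (auto simp: s_def)
    next
      case False
      then show ?thesis
        using w0 by (intro image_eqI[of _ _ "(0, w0)"]) (auto simp: s_def)
    qed
    ultimately have "y \<in> Z"
      unfolding Z_def set_sum_alt[OF finite_lessThan] by blast
    with y0 show "y \<in> Z \<inter> {y. Poly_Mapping.lookup y 0 = 1}"
      by simp
  qed
  moreover have "closed {y. Poly_Mapping.lookup y (0 :: nat ^ 'a) = (1::real)}"
    by (intro closed_Collect_eq continuous_intros)
  ultimately show ?thesis
    using Z by (simp add: compact_Int_closed)
qed (simp add: moment_body_def)

subsection \<open>Duality\<close>

text \<open>Each summand of a decomposition of \<open>f - const_poly c\<close> pairs non-negatively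
  with the matching restriction of \<open>v\<close>, and the zero coordinate 1 turns
  \<open>const_poly c\<close> into \<open>c\<close>.\<close>

lemma weak_duality:
  assumes "\<And>i. i \<in> {1..N} \<Longrightarrow> finite (P i)"
    and "c \<in> primal_feasible N P X f" "v \<in> cone_feasible N P X"
  shows "c \<le> Lfun v f"
proof -
  obtain g where g: "f - const_poly c = (\<Sum>i\<in>{1..N}. g i)"
    "\<And>i. i \<in> {1..N} \<Longrightarrow> g i \<in> nonneg_polys (P i) X"
    using assms(2) unfolding primal_feasible_def set_sum_alt[OF finite_atLeastAtMost] by auto
  have "0 \<le> Lfun v (g i)" if i: "i \<in> {1..N}" for i
  proof -
    have "restrict_coords (P i) v \<in> moment_cone (P i) X"
      using assms(3) i by (simp add: cone_feasible_def)
    from Lfun_moment_cone_nonneg[OF assms(1)[OF i] g(2)[OF i] this] show ?thesis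
      using g(2)[OF i] assms(1)[OF i]
      by (simp add: Lfun_restrict_coords nonneg_polys_def poly_space_eq_coord_space)
  qed
  then have "0 \<le> Lfun v (f - const_poly c)"
    unfolding g(1) linear_sum[OF bounded_linear.linear[OF bounded_linear_Lfun_right]]
    by (rule sum_nonneg)
  then show ?thesis
    using assms(3) by (simp add: Lfun_simps cone_feasible_def)
qed

lemma moment_vec_in_cone_feasible:
  assumes "\<And>i. i \<in> {1..N} \<Longrightarrow> finite (P i)" "0 \<in> (\<Union>i\<in>{1..N}. P i)" "x \<in> X"
  shows "moment_vec (\<Union>i\<in>{1..N}. P i) x \<in> cone_feasible N P X"
proof -
  let ?B = "\<Union>i\<in>{1..N}. P i"
  have B: "finite ?B"
    using assms by auto
  have "restrict_coords (P i) (moment_vec ?B x) = moment_vec (P i) x" if "i \<in> {1..N}" for i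
    using that by (intro restrict_moment_vec[OF B]) auto
  moreover have "Poly_Mapping.lookup (moment_vec ?B x) 0 = 1"
    using assms(2) lookup_moment_vec[OF B, of x 0] by simp
  ultimately show ?thesis
    using moment_vec_in_coord_space[OF B] moment_vec_in_moment_cone[OF assms(3)]
    by (simp add: cone_feasible_def)
qed

text \<open>Separating \<open>f - const_poly c\<close> from the closed sum of cones yields a
  \<open>v\<close> whose restrictions lie in the moment cones. It remains to normalise its zero
  coordinate: rescale if it is positive; if it is 0, \<open>v\<close> is a recession direction along
  which the objective decreases without bound.\<close>

lemma strong_duality:
  fixes X :: "(real ^ 'n::finite) set"
  assumes P: "\<And>i. i \<in> {1..N} \<Longrightarrow> finite (P i)"
    and B: "0 \<in> (\<Union>i\<in>{1..N}. P i)" "f \<in> coord_space (\<Union>i\<in>{1..N}. P i)"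
    and X: "interior X \<noteq> {}" and c: "c \<notin> primal_feasible N P X f"
  obtains v where "v \<in> cone_feasible N P X" "Lfun v f < c"
proof -
  let ?B = "\<Union>i\<in>{1..N}. P i" and ?K = "\<Sum>i\<in>{1..N}. nonneg_polys (P i) X"
  have fB: "finite ?B"
    using P by auto
  have in_K: "g \<in> ?K" if "i \<in> {1..N}" "g \<in> nonneg_polys (P i) X" for g i
    unfolding set_sum_alt[OF finite_atLeastAtMost]
  proof (intro CollectI exI conjI ballI)
    \<comment> \<open>An element of one cone lies in the sum since every other cone contributes
      0.\<close>
    show "g = (\<Sum>j\<in>{1..N}. if j = i then g else 0)"
      using that by simp
    show "(if j = i then g else 0) \<in> nonneg_polys (P j) X" for j
      using that by (simp add: convex_cone_contains_0[OF convex_cone_nonneg_polys])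
  qed
  have "?K \<subseteq> coord_space ?B"
    unfolding set_sum_alt[OF finite_atLeastAtMost]
  proof safe
    fix g assume g: "\<forall>i\<in>{1..N}. g i \<in> nonneg_polys (P i) X"
    have "g i \<in> coord_space ?B" if "i \<in> {1..N}" for i
      using g that unfolding nonneg_polys_def poly_space_def coord_space_def by blast
    then show "(\<Sum>i\<in>{1..N}. g i) \<in> coord_space ?B"
      by (intro subspace_sum subspace_coord_space)
  qed
  moreover have "convex_cone ?K"
    by (intro convex_cone_set_sum convex_cone_nonneg_polys) auto
  moreover have "closed ?K"
    using P B X by (intro closed_sum_nonneg_polys) auto
  moreover have "const_poly c \<in> coord_space ?B"
    using B by (auto simp: const_poly_def coord_space_iff lookup_single when_def)
  then have "f - const_poly c \<in> coord_space ?B"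
    using B by (intro subspace_diff subspace_coord_space)
  moreover have "f - const_poly c \<notin> ?K"
    using c by (simp add: primal_feasible_def)
  ultimately obtain v where v: "v \<in> coord_space ?B" "\<And>g. g \<in> ?K \<Longrightarrow> 0 \<le> Lfun v g"
    "Lfun v (f - const_poly c) < 0"
    using separate_closed_convex_cone[OF fB] by metis
  have vcone: "restrict_coords (P i) v \<in> moment_cone (P i) X" if i: "i \<in> {1..N}" for i
  proof (rule moment_cone_dual)
    fix g assume g: "g \<in> nonneg_polys (P i) X"
    then show "0 \<le> Lfun (restrict_coords (P i) v) g"
      using v(2)[OF in_K[OF i g]] P[OF i]
      by (simp add: Lfun_restrict_coords nonneg_polys_def poly_space_eq_coord_space)
  qed (use P i restrict_coords_in_coord_space in auto)
  have neg: "Lfun v f < c * Poly_Mapping.lookup v 0"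
    using v(3) by (simp add: Lfun_simps)
  obtain k where k: "k \<in> {1..N}" "0 \<in> P k"
    using B by blast
  have "0 \<le> Poly_Mapping.lookup v 0"
    using v(2)[OF in_K[OF k(1) const_poly_nonneg[OF k(2), of 1]]] by simp
  obtain x where "x \<in> X"
    using X interior_subset by blast
  then obtain w where "w \<in> cone_feasible N P X"
    using moment_vec_in_cone_feasible[OF P B(1)] by blast
  then have w: "w \<in> coord_space ?B" "Poly_Mapping.lookup w 0 = 1"
    and wcone: "\<And>i. i \<in> {1..N} \<Longrightarrow> restrict_coords (P i) w \<in> moment_cone (P i) X"
    by (auto simp: cone_feasible_def)
  have feasible: "a *\<^sub>R w + b *\<^sub>R v \<in> cone_feasible N P X"
    if "0 \<le> a" "0 \<le> b" "a + b * Poly_Mapping.lookup v 0 = 1" for a b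
  proof -
    have "restrict_coords (P i) (a *\<^sub>R w + b *\<^sub>R v) \<in> moment_cone (P i) X" if i: "i \<in> {1..N}" for i
    proof -
      note lin = bounded_linear.linear[OF bounded_linear_restrict_coords[OF P[OF i]]]
      have "convex_cone (moment_cone (P i) X)"
        by (simp add: moment_cone_def convex_cone_closure convex_cone_convex_cone_hull)
      then show ?thesis
        using \<open>0 \<le> a\<close> \<open>0 \<le> b\<close> vcone[OF i] wcone[OF i]
        by (simp add: linear_add[OF lin] linear_cmul[OF lin] convex_cone_add convex_cone_scaleR)
    qed
    then show ?thesis
      using v w that(3) unfolding cone_feasible_def
      by (simp add: subspace_add subspace_scale subspace_coord_space lookup_add)
  qed
  show ?thesis
  proof (cases "Poly_Mapping.lookup v 0 = 0")
    case True
    \<comment> \<open>Large enough that adding \<open>b *\<^sub>R v\<close> to the feasible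
      \<open>w\<close> lowers the objective by more than \<open>Lfun w f - c\<close>.\<close>
    define b where "b = (\<bar>Lfun w f - c\<bar> + 1) / - Lfun v f"
    have "0 < - Lfun v f"
      using neg True by simp
    then have "0 \<le> b" "b * Lfun v f = - (\<bar>Lfun w f - c\<bar> + 1)"
      by (auto simp: b_def field_simps)
    then show ?thesis
      using feasible[of 1 b] True that[of "1 *\<^sub>R w + b *\<^sub>R v"] by (simp add: Lfun_simps)
  next
    case False
    define b where "b = 1 / Poly_Mapping.lookup v 0"
    have "0 < b"
      using False \<open>0 \<le> Poly_Mapping.lookup v 0\<close> by (simp add: b_def)
    moreover have "b * Lfun v f < c"
      using neg False \<open>0 \<le> Poly_Mapping.lookup v 0\<close> by (simp add: b_def field_simps)
    ultimately show ?thesis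
      using feasible[of 0 b] False that[of "0 *\<^sub>R w + b *\<^sub>R v"] by (simp add: b_def Lfun_simps)
  qed
qed

section \<open>Moment bodies as feasible sets\<close>

lemma body_feasible_subset_cone_feasible:
  assumes "\<And>i. i \<in> {1..N} \<Longrightarrow> finite (P i)" "0 \<in> (\<Union>i\<in>{1..N}. P i)"
  shows "body_feasible N P X \<subseteq> cone_feasible N P X"
proof
  fix v assume v: "v \<in> body_feasible N P X"
  \<comment> \<open>Body feasibility does not ask for zero coordinate 1 explicitly; any index set
    containing 0 enforces it.\<close>
  obtain k where k: "k \<in> {1..N}" "0 \<in> P k"
    using assms by blast
  then have "Poly_Mapping.lookup (restrict_coords (P k) v) 0 = 1"
    using v assms(1) by (intro moment_body_lookup_zero) (auto simp: body_feasible_def)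
  then have "Poly_Mapping.lookup v 0 = 1"
    using k assms(1) by (simp add: lookup_restrict_coords)
  moreover have "moment_body Q X \<subseteq> moment_cone Q X" for Q
    unfolding moment_body_def moment_cone_def
    using convex_hull_subset_convex_cone_hull closure_subset by (rule order_trans)
  ultimately show "v \<in> cone_feasible N P X"
    using v by (auto simp: body_feasible_def cone_feasible_def)
qed

text \<open>The interior functional and its radius are common to all \<open>P i\<close>, so a single
  shift moves every restriction into its moment body.\<close>

lemma body_feasible_approximates_cone_feasible:
  fixes X :: "(real ^ 'n::finite) set"
  assumes P: "\<And>i. i \<in> {1..N} \<Longrightarrow> finite (P i)" "\<And>i. i \<in> {1..N} \<Longrightarrow> 0 \<in> P i" and N: "1 \<le> N"
    and X: "interior X \<noteq> {}"
  obtains w where "\<And>v e. v \<in> cone_feasible N P X \<Longrightarrow> 0 < e \<Longrightarrow> e < 1 \<Longrightarrow>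
    (1 - e) *\<^sub>R v + e *\<^sub>R w \<in> body_feasible N P X"
proof -
  let ?B = "\<Union>i\<in>{1..N}. P i"
  have "finite ?B" "0 \<in> ?B"
    using P N by auto
  then obtain w r where r: "0 < r" and w: "w \<in> coord_space ?B" "Poly_Mapping.lookup w 0 = 1"
    "\<And>Q u. Q \<subseteq> ?B \<Longrightarrow> u \<in> coord_box Q r \<Longrightarrow>
      restrict_coords Q w + u \<in> convex_cone hull (moment_vec Q ` X)"
    using interior_moment_functional[OF _ _ X] by metis
  show ?thesis
  proof (rule that[of w])
    fix v and e :: real assume v: "v \<in> cone_feasible N P X" and e: "0 < e" "e < 1"
    have "restrict_coords (P i) ((1 - e) *\<^sub>R v + e *\<^sub>R w) \<in> moment_body (P i) X" if i: "i \<in> {1..N}" for i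
    proof -
      note lin = bounded_linear.linear[OF bounded_linear_restrict_coords[OF P(1)[OF i]]]
      have "(1 - e) *\<^sub>R restrict_coords (P i) v + e *\<^sub>R restrict_coords (P i) w \<in> moment_body (P i) X"
        using v i r P w e
        by (intro interior_shift_in_moment_body[where r = r])
          (auto simp: cone_feasible_def lookup_restrict_coords intro!: w(3))
      then show ?thesis
        by (simp add: linear_add[OF lin] linear_cmul[OF lin])
    qed
    then show "(1 - e) *\<^sub>R v + e *\<^sub>R w \<in> body_feasible N P X"
      using v w by (simp add: body_feasible_def cone_feasible_def subspace_add subspace_scale
          subspace_coord_space)
  qed
qed

text \<open>Each coordinate in the union occurs in some restriction, so the bounds of the compact
  moment bodies bound \<open>v\<close>; closedness follows from continuity of the
  restrictions.\<close>

lemma compact_body_feasible: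
  fixes X :: "(real ^ 'n::finite) set"
  assumes P: "\<And>i. i \<in> {1..N} \<Longrightarrow> finite (P i)" "\<And>i. i \<in> {1..N} \<Longrightarrow> 0 \<in> P i" and X: "compact X"
  shows "compact (body_feasible N P X)"
proof -
  let ?B = "\<Union>i\<in>{1..N}. P i"
  have body: "compact (moment_body (P i) X)" if "i \<in> {1..N}" for i
    using that P X by (intro compact_moment_body) auto
  have "compact (\<Union>i\<in>{1..N}. moment_body (P i) X)"
    using body by (intro compact_UN) auto
  then obtain R where R: "0 < R" "\<And>y. y \<in> (\<Union>i\<in>{1..N}. moment_body (P i) X) \<Longrightarrow> norm y \<le> R"
    using compact_imp_bounded bounded_pos by metis
  have "body_feasible N P X \<subseteq> coord_box ?B R"
  proof
    fix v assume v: "v \<in> body_feasible N P X"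
    have "\<bar>Poly_Mapping.lookup v a\<bar> \<le> R" for a
    proof (cases "a \<in> ?B")
      case True
      then obtain i where i: "i \<in> {1..N}" "a \<in> P i"
        by blast
      then have "restrict_coords (P i) v \<in> (\<Union>i\<in>{1..N}. moment_body (P i) X)"
        using v unfolding body_feasible_def by blast
      from R(2)[OF this] show ?thesis
        using norm_lookup_le[of "restrict_coords (P i) v" a] i P by (simp add: lookup_restrict_coords)
    next
      case False
      then show ?thesis
        using v R by (auto simp: body_feasible_def coord_space_iff)
    qed
    then show "v \<in> coord_box ?B R"
      using v by (simp add: coord_box_def body_feasible_def)
  qed
  moreover have "closed (body_feasible N P X)"
  proof -
    have "body_feasible N P X = coord_space ?B \<inter> (\<Inter>i\<in>{1..N}. restrict_coords (P i) -` moment_body (P i) X)"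
      by (auto simp: body_feasible_def)
    also have "closed \<dots>"
      using P body
      by (intro closed_Int closed_coord_space closed_INT ballI continuous_closed_vimage
          compact_imp_closed bounded_linear.isCont[OF bounded_linear_restrict_coords]) auto
    finally show ?thesis .
  qed
  moreover have "finite ?B"
    using P by auto
  ultimately show ?thesis
    by (intro compact_closed_subset_coord_box)
qed

theorem proposition3p11:
  fixes N :: nat and P :: "nat \<Rightarrow> (nat ^ 'n::finite) set" and A :: "(nat ^ 'n) set"
    and f :: "'n mpoly" and X :: "(real ^ 'n) set"
  assumes "\<And>i. i \<in> {1..N} \<Longrightarrow> finite (P i)"
    and "finite A"
    and "{0} \<union> A \<subseteq> (\<Union>i\<in>{1..N}. P i)"
    and "f \<in> poly_space A"
    and "interior X \<noteq> {}"
  shows "(SUP c\<in>primal_feasible N P X f. ereal c) = (INF v\<in>cone_feasible N P X. ereal (Lfun v f)) \<and>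
    ((\<forall>i\<in>{1..N}. 0 \<in> P i) \<longrightarrow>
      (INF v\<in>cone_feasible N P X. ereal (Lfun v f)) = (INF v\<in>body_feasible N P X. ereal (Lfun v f)) \<and>
      (compact X \<longrightarrow>
        (\<exists>c\<in>primal_feasible N P X f. ereal c = (SUP c\<in>primal_feasible N P X f. ereal c)) \<and>
        (\<exists>v\<in>cone_feasible N P X. ereal (Lfun v f) = (INF v\<in>cone_feasible N P X. ereal (Lfun v f))) \<and>
        (\<exists>v\<in>body_feasible N P X. ereal (Lfun v f) = (INF v\<in>body_feasible N P X. ereal (Lfun v f)))))"
proof -
  let ?B = "\<Union>i\<in>{1..N}. P i"
  let ?primal = "SUP c\<in>primal_feasible N P X f. ereal c"
  let ?dual = "INF v\<in>cone_feasible N P X. ereal (Lfun v f)"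
  let ?body = "INF v\<in>body_feasible N P X. ereal (Lfun v f)"
  note P = assms(1)
  have B: "0 \<in> ?B" "f \<in> coord_space ?B"
    using assms(3,4) by (auto simp: poly_space_def coord_space_def)
  note strong = strong_duality[OF P B assms(5)]
  have duality: "?primal = ?dual"
  proof (rule antisym)
    show "?primal \<le> ?dual"
      using weak_duality[OF P] by (intro SUP_least INF_greatest) simp
    show "?dual \<le> ?primal"
    proof (rule ccontr)
      assume "\<not> ?dual \<le> ?primal"
      \<comment> \<open>A real number in the gap exists even if one side is infinite, so empty and
        unbounded problems need no separate treatment.\<close>
      then obtain c where c: "?primal < ereal c" "ereal c < ?dual"
        using ereal_dense2[of ?primal ?dual] by (auto simp: not_le)
      have "c \<notin> primal_feasible N P X f"
        using c(1) by (metis SUP_upper leD)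
      then obtain v where "v \<in> cone_feasible N P X" "Lfun v f < c"
        using strong by blast
      then have "?dual < ereal c"
        unfolding INF_less_iff by auto
      with c(2) show False
        by simp
    qed
  qed
  have more: "?dual = ?body \<and> (compact X \<longrightarrow>
      (\<exists>c\<in>primal_feasible N P X f. ereal c = ?primal) \<and>
      (\<exists>v\<in>cone_feasible N P X. ereal (Lfun v f) = ?dual) \<and>
      (\<exists>v\<in>body_feasible N P X. ereal (Lfun v f) = ?body))"
    if zero: "\<forall>i\<in>{1..N}. 0 \<in> P i"
  proof -
    have "1 \<le> N"
      using B by (cases N) auto
    then obtain w where w: "\<And>v e. v \<in> cone_feasible N P X \<Longrightarrow> 0 < e \<Longrightarrow> e < 1 \<Longrightarrow>
        (1 - e) *\<^sub>R v + e *\<^sub>R w \<in> body_feasible N P X"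
      using body_feasible_approximates_cone_feasible[of N P X] P zero assms(5) by blast
    have sub: "body_feasible N P X \<subseteq> cone_feasible N P X"
      by (rule body_feasible_subset_cone_feasible[OF P B(1)])
    have lim: "((\<lambda>e. (1 - e) *\<^sub>R v + e *\<^sub>R w) \<longlongrightarrow> v) (at_right 0)" for v
    proof -
      have "((\<lambda>e. (1 - e) *\<^sub>R v + e *\<^sub>R w) \<longlongrightarrow> (1 - 0) *\<^sub>R v + 0 *\<^sub>R w) (at_right 0)"
        by (intro tendsto_intros)
      then show ?thesis
        by simp
    qed
    have eq: "?dual = ?body"
    proof (rule antisym)
      show "?dual \<le> ?body"
        by (rule INF_superset_mono[OF sub order_refl])
      show "?body \<le> ?dual"
      proof (rule INF_greatest)
        fix v assume v: "v \<in> cone_feasible N P X"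
        show "?body \<le> ereal (Lfun v f)"
        proof (rule tendsto_lowerbound)
          show "((\<lambda>e. ereal (Lfun ((1 - e) *\<^sub>R v + e *\<^sub>R w) f)) \<longlongrightarrow> ereal (Lfun v f)) (at_right 0)"
            by (intro tendsto_ereal bounded_linear.tendsto[OF bounded_linear_Lfun_left] lim)
          show "\<forall>\<^sub>F e in at_right 0. ?body \<le> ereal (Lfun ((1 - e) *\<^sub>R v + e *\<^sub>R w) f)"
            using w[OF v] by (intro eventually_at_rightI[of 0 1] INF_lower) auto
        qed simp
      qed
    qed
    have "(\<exists>c\<in>primal_feasible N P X f. ereal c = ?primal) \<and>
      (\<exists>v\<in>cone_feasible N P X. ereal (Lfun v f) = ?dual) \<and>
      (\<exists>v\<in>body_feasible N P X. ereal (Lfun v f) = ?body)" if "compact X"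
    proof -
      have compact: "compact (body_feasible N P X)"
        using zero that by (intro compact_body_feasible P) auto
      \<comment> \<open>A cone-feasible \<open>v\<close> is the limit of its shifts as
        \<open>e\<close> tends to 0; closedness of the body-feasible set makes the two feasible sets
        equal.\<close>
      have "v \<in> body_feasible N P X" if "v \<in> cone_feasible N P X" for v
      proof (rule Lim_in_closed_set[OF compact_imp_closed[OF compact] _ _ lim])
        show "\<forall>\<^sub>F e in at_right 0. (1 - e) *\<^sub>R v + e *\<^sub>R w \<in> body_feasible N P X"
          using w[OF that] by (intro eventually_at_rightI[of 0 1]) auto
      qed simp
      then have feasible_eq: "cone_feasible N P X = body_feasible N P X"
        using sub by blast
      obtain x where "x \<in> X"
        using assms(5) interior_subset by blast
      then have "moment_vec ?B x \<in> cone_feasible N P X"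
        using moment_vec_in_cone_feasible[OF P B(1)] by blast
      then have "body_feasible N P X \<noteq> {}"
        unfolding feasible_eq by blast
      then obtain v where v: "v \<in> body_feasible N P X"
        "\<And>u. u \<in> body_feasible N P X \<Longrightarrow> Lfun v f \<le> Lfun u f"
        using continuous_attains_inf[OF compact, of "\<lambda>v. Lfun v f"]
          bounded_linear.continuous_on[OF bounded_linear_Lfun_left continuous_on_id] by blast
      have body: "ereal (Lfun v f) = ?body"
        using v by (intro antisym INF_greatest INF_lower) auto
      \<comment> \<open>Otherwise strong duality would supply a feasible point with value below the
        minimum.\<close>
      moreover have "Lfun v f \<in> primal_feasible N P X f"
        using strong[of "Lfun v f"] v(2) feasible_eq by (metis leD)
      ultimately show ?thesis
        using v feasible_eq duality by auto
    qed
    with eq show ?thesis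
      by blast
  qed
  from duality more show ?thesis
    by blast
qed

end
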